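(* Suppose that for every $n\ge1$, every $\alpha\in\mathbb N^n$ and every $i\in[n]$, the product $x_1\cdots x_i(1-x_{i+1})\cdots(1-x_n)\,\mathfrak L_\alpha$ is a graded nonnegative linear combination of Lascoux polynomials. Then for every \%-avoiding diagram $D\subseteq[n]\times[m]$, the polynomial $$x_1^m\cdots x_n^m\,\mathscr S_D(x_n^{-1},\dots,x_1^{-1};-1,\dots,-1)$$ is a graded nonnegative sum of Lascoux polynomials $\mathfrak L_\alpha(x_1,\dots,x_n)$; in particular, the same holds for $$x_1^n\cdots x_n^n\,\mathfrak S_w(x_n^{-1},\dots,x_1^{-1};1,\dots,1)$$ for every $w\in S_n$.
   Context: Notation: $[n]=\{1,\dots,n\}$, $\mathbb N=\{0,1,2,\dots\}$, $|\alpha|=\alpha_1+\dots+\alpha_n$. Operators. On polynomials in $x_1,\dots,x_n$ and variables $y_j$ ($j\in\mathbb Z$), for $i\in[n-1]$ let $s_i$ swap $x_i,x_{i+1}$ and set $\partial_i(f)=\frac{f-s_if}{x_i-x_{i+1}}$, $\overline\partial_i(f)=\partial_i((1-x_{i+1})f)$, $\overline\pi_i(f)=\overline\partial_i(x_if)$, and $\pi_{i,j}(f)=\partial_i((x_i+y_j)f)$. For $i\in[n]$ and a finite set $M$ of positive integers, $\omega_i^M=\prod_{a\in[i],\,m\in M}(x_a+y_m)$. Diagrams. A diagram is a subset $D\subseteq[n]\times[m]$, identified with its columns $(D_1,\dots,D_m)$, $D_j=\{i\in[n]:(i,j)\in D\}$. $D$ is \%-avoiding if whenever $i_1<i_2$,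 $j_1<j_2$, $i_2\in D_{j_1}$ and $i_1\in D_{j_2}$, then $i_1\in D_{j_1}$ or $i_2\in D_{j_2}$. Double orthodontic sequence of a \%-avoiding diagram $D$. Set $K_i=\{j: D_j=[i]\}$ for $i\in[n]$, and let $D_-$ be $D$ with all these columns replaced by empty columns. A missing tooth of a column $C\subseteq[n]$ is $i\in[n-1]$ with $i\notin C$, $i+1\in C$. If the current diagram $E$ (initially $E=D_-$) is nonempty, perform the $k$-th orthodontic step ($k=1,2,\dots$): let $E_j$ be the leftmost nonempty column of $E$, let $i_k$ be its smallest missing tooth, and let $j_k=j-\#\{a\le i_k: a\notin E_j\}$ (which may be $\le 0$); swap rows $i_k$ and $i_k+1$ of $E$ to get $E'$; let $M_k=\{j:E'_j=[i_k]\}$; let $E''$ be $E'$ with the columns equal to $[i_k]$ replaced by empty columns, and continue with $E''$. Stop when the diagram is empty (this always happens after finitely many steps); $\ell$ is the number of steps. Then $$\mathscr S_D(\mathbf x;\mathbf y)=\omega_1^{K_1}\cdots\omega_n^{K_n}\,\pi_{i_1,j_1}\bigl(\omega_{i_1}^{M_1}\,\pi_{i_2,j_2}(\omega_{i_2}^{M_2}\cdots\pi_{i_\ell,j_\ell}(\omega_{i_\ell}^{M_\ell})\cdots)\bigr).$$ In the specialization of $\mathscr S_D$, every $y$-variable (including those with nonpositive index) is set to $-1$. Double Schubert polynomials. With $w_0\in S_n$ the longest permutation and $ws_i$ denoting $w$ with the values $w(i),w(i+1)$ swapped: $\mathfrak S_{w_0}(\mathbf x;\mathbf y)=\prod_{i+j\le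 n}(x_i-y_j)$, and $\mathfrak S_w=\partial_i\mathfrak S_{ws_i}$ if $\ell(w)<\ell(ws_i)$. Lascoux polynomials. For $\alpha\in\mathbb N^n$, $\mathfrak L_\alpha=x_1^{\alpha_1}\cdots x_n^{\alpha_n}$ if $\alpha_1\ge\dots\ge\alpha_n$, and $\mathfrak L_\alpha=\overline\pi_i\mathfrak L_{\alpha\cdot s_i}$ if $\alpha_i<\alpha_{i+1}$, where $\alpha\cdot s_i$ is $\alpha$ with entries $i,i+1$ swapped. A nonzero polynomial $f$ is a graded nonnegative sum (linear combination) of Lascoux polynomials if $f=\sum_\alpha(-1)^{|\alpha|-d}c_\alpha\mathfrak L_\alpha$ (a finite sum) with all $c_\alpha\ge0$, where $d$ is the lowest total degree of a term of $f$. *)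

theory Defs
  imports
    "HOL-Library.Poly_Mapping"
    "HOL-Combinatorics.Permutations"
    "HOL-Computational_Algebra.Polynomial_Factorial"
begin

section \<open>Polynomials in the variables \<open>x\<^sub>i\<close> and \<open>y\<^sub>j\<close>\<close>

datatype indet = X nat | Y int

text \<open>The order on variables has no mathematical meaning here; it only makes the type of
  polynomials below an instance of \<^class>\<open>idom\<close>.\<close>

instantiation indet :: linorder
begin

definition less_eq_indet :: "indet \<Rightarrow> indet \<Rightarrow> bool" where
  "v \<le> w \<longleftrightarrow> (case (v, w) of
      (X i, X j) \<Rightarrow> i \<le> j | (X _, Y _) \<Rightarrow> True | (Y _, X _) \<Rightarrow> False | (Y i, Y j) \<Rightarrow> i \<le> j)"

definition less_indet :: "indet \<Rightarrow> indet \<Rightarrow> bool" where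
  "(v :: indet) < w \<longleftrightarrow> v \<le> w \<and> \<not> w \<le> v"

instance
  by standard (auto simp: less_eq_indet_def less_indet_def split: indet.splits)

end

type_synonym monomial = "indet \<Rightarrow>\<^sub>0 nat"
type_synonym xypoly = "monomial \<Rightarrow>\<^sub>0 int"

definition var :: "indet \<Rightarrow> xypoly" where
  "var v = Poly_Mapping.single (Poly_Mapping.single v 1) 1"

abbreviation xv :: "nat \<Rightarrow> xypoly" where "xv i \<equiv> var (X i)"
abbreviation yv :: "int \<Rightarrow> xypoly" where "yv j \<equiv> var (Y j)"

definition subst :: "(indet \<Rightarrow> 'a::comm_ring_1) \<Rightarrow> xypoly \<Rightarrow> 'a" where
  "subst \<sigma> f = (\<Sum>p\<in>Poly_Mapping.keys f. of_int (Poly_Mapping.lookup f p) * (\<Prod>v\<in>Poly_Mapping.keys p. \<sigma> v ^ Poly_Mapping.lookup p v))"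

definition lowest_degree :: "xypoly \<Rightarrow> nat" where
  "lowest_degree f = Min ((\<lambda>p. \<Sum>v\<in>Poly_Mapping.keys p. Poly_Mapping.lookup p v) ` Poly_Mapping.keys f)"

text \<open>The Laurent polynomial \<open>f(x\<^sub>n\<inverse>, \<dots>, x\<^sub>1\<inverse>; c, \<dots>, c)\<close>, as an element of the field of
  rational functions. The value at \<open>x\<^sub>i\<close> with \<open>i \<notin> {1..n}\<close> is irrelevant.\<close>

definition reversed_inverse :: "nat \<Rightarrow> int \<Rightarrow> xypoly \<Rightarrow> xypoly fract" where
  "reversed_inverse n c =
    subst (\<lambda>v. case v of X i \<Rightarrow> inverse (to_fract (xv (n + 1 - i))) | Y _ \<Rightarrow> of_int c)"


section \<open>Operators\<close>

definition swap_vars :: "nat \<Rightarrow> xypoly \<Rightarrow> xypoly" where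
  "swap_vars i =
    subst (\<lambda>v. case v of X k \<Rightarrow> xv (transpose i (Suc i) k) | Y j \<Rightarrow> yv j)"

text \<open>The quotient \<open>(f - s\<^sub>i f) / (x\<^sub>i - x\<^sub>i\<^sub>+\<^sub>1)\<close>; it exists and is unique by
  \<open>divided_difference\<close> below.\<close>

definition dd :: "nat \<Rightarrow> xypoly \<Rightarrow> xypoly" where
  "dd i f = (THE g. (xv i - xv (Suc i)) * g = f - swap_vars i f)"

definition dd_bar :: "nat \<Rightarrow> xypoly \<Rightarrow> xypoly" where
  "dd_bar i f = dd i ((1 - xv (Suc i)) * f)"

definition pi_bar :: "nat \<Rightarrow> xypoly \<Rightarrow> xypoly" where
  "pi_bar i f = dd_bar i (xv i * f)"

definition pi_op :: "nat \<Rightarrow> int \<Rightarrow> xypoly \<Rightarrow> xypoly" where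
  "pi_op i j f = dd i ((xv i + yv j) * f)"

definition omega :: "nat \<Rightarrow> nat set \<Rightarrow> xypoly" where
  "omega i M = (\<Prod>a\<in>{1..i}. \<Prod>m\<in>M. xv a + yv (int m))"

lemma subst_var_self: "subst var f = f"
proof -
  have pw: "var v ^ k = Poly_Mapping.single (Poly_Mapping.single v k) 1" for v k
    by (induction k) (simp_all add: var_def mult_single single_add [symmetric])
  have pr: "(\<Prod>v\<in>A. Poly_Mapping.single (h v) (1::int)) = Poly_Mapping.single (sum h A) 1"
    for A :: "indet set" and h :: "indet \<Rightarrow> monomial"
    by (induction A rule: infinite_finite_induct) (simp_all add: mult_single)
  have dec: "(\<Sum>k\<in>Poly_Mapping.keys q. Poly_Mapping.single k (Poly_Mapping.lookup q k)) = q"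
    for q :: "'k \<Rightarrow>\<^sub>0 'b::comm_monoid_add"
  proof (rule poly_mapping_eqI)
    fix k
    show "Poly_Mapping.lookup (\<Sum>k\<in>Poly_Mapping.keys q.
        Poly_Mapping.single k (Poly_Mapping.lookup q k)) k = Poly_Mapping.lookup q k"
      by (simp add: lookup_sum lookup_single when_def in_keys_iff)
  qed
  have ofint: "of_int c = Poly_Mapping.single (0::monomial) c" for c
    by (metis single_of_int of_int_eq_id id_apply)
  show ?thesis
    by (simp add: subst_def pw pr dec ofint mult_single)
qed

lemma divided_difference: "\<exists>!g. (xv i - xv (Suc i)) * g = f - swap_vars i f"
proof -
  define u where "u = xv i - xv (Suc i)"
  define \<sigma> where "\<sigma> = (\<lambda>v. case v of X k \<Rightarrow> xv (transpose i (Suc i) k) | Y j \<Rightarrow> yv j)"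
  have "xv i \<noteq> xv (Suc i)"
    by (auto simp: var_def dest!: arg_cong [where f = Poly_Mapping.keys])
  hence u: "u \<noteq> 0" by (simp add: u_def)
  have v: "u dvd var v - \<sigma> v" for v
    by (cases v) (auto simp: u_def \<sigma>_def transpose_def minus_diff_eq [of "xv (Suc i)", symmetric]
        simp del: minus_diff_eq)
  have mult: "u dvd a * b - a' * b'" if "u dvd a - a'" "u dvd b - b'" for a b a' b'
  proof -
    have "a * b - a' * b' = (a - a') * b + a' * (b - b')" by (simp add: algebra_simps)
    with that show ?thesis by simp
  qed
  have pow: "u dvd var v ^ k - \<sigma> v ^ k" for v k
    by (induction k) (simp_all add: mult v)
  have pr: "u dvd (\<Prod>v\<in>A. var v ^ h v) - (\<Prod>v\<in>A. \<sigma> v ^ h v)" for A h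
    by (induction A rule: infinite_finite_induct) (simp_all add: mult pow)
  have "u dvd subst var f - subst \<sigma> f"
    unfolding subst_def sum_subtractf [symmetric] right_diff_distrib [symmetric]
    by (intro dvd_sum dvd_mult pr)
  hence "u dvd f - swap_vars i f"
    by (simp add: subst_var_self swap_vars_def \<sigma>_def)
  with u show ?thesis
    unfolding u_def [symmetric] by (metis dvdE mult_left_cancel)
qed


section \<open>Lascoux polynomials\<close>

definition compositions :: "nat \<Rightarrow> (nat \<Rightarrow> nat) set" where
  "compositions n = {\<alpha>. \<forall>i. i \<notin> {1..n} \<longrightarrow> \<alpha> i = 0}"

definition weight :: "nat \<Rightarrow> (nat \<Rightarrow> nat) \<Rightarrow> nat" where
  "weight n \<alpha> = (\<Sum>i=1..n. \<alpha> i)"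

inductive lascoux_rel :: "nat \<Rightarrow> (nat \<Rightarrow> nat) \<Rightarrow> xypoly \<Rightarrow> bool" for n where
  dominant: "lascoux_rel n \<alpha> (\<Prod>i=1..n. xv i ^ \<alpha> i)"
    if "\<alpha> \<in> compositions n" "\<And>i. i \<in> {1..<n} \<Longrightarrow> \<alpha> (Suc i) \<le> \<alpha> i"
| ascent: "lascoux_rel n \<alpha> (pi_bar i f)"
    if "\<alpha> \<in> compositions n" "i \<in> {1..<n}" "\<alpha> i < \<alpha> (Suc i)"
      "lascoux_rel n (\<alpha> \<circ> transpose i (Suc i)) f"

text \<open>The operators \<open>pi_bar\<close> satisfy the braid relations, so the value does not depend on the
  chosen ascents: the relation is functional on \<open>compositions n\<close>. The same reason makes
  \<open>double_schubert\<close> below well defined.\<close>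

definition lascoux :: "nat \<Rightarrow> (nat \<Rightarrow> nat) \<Rightarrow> xypoly" where
  "lascoux n \<alpha> = (THE f. lascoux_rel n \<alpha> f)"

text \<open>The sign \<open>(-1)\<^bsup>|\<alpha>| - d\<^esup>\<close> is written with exponent \<open>|\<alpha>| + d\<close>, which has the same parity,
  since subtraction on \<^typ>\<open>nat\<close> truncates.\<close>

definition graded_nonneg :: "nat \<Rightarrow> xypoly \<Rightarrow> bool" where
  "graded_nonneg n f \<longleftrightarrow> f \<noteq> 0 \<and>
    (\<exists>A c. finite A \<and> A \<subseteq> compositions n \<and> (\<forall>\<alpha>\<in>A. (c \<alpha> :: int) \<ge> 0) \<and>
      f = (\<Sum>\<alpha>\<in>A. (-1) ^ (weight n \<alpha> + lowest_degree f) * of_int (c \<alpha>) * lascoux n \<alpha>))"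


section \<open>Double Schubert polynomials\<close>

definition inversions :: "nat \<Rightarrow> (nat \<Rightarrow> nat) \<Rightarrow> nat" where
  "inversions n w = card {(i, j). 1 \<le> i \<and> i < j \<and> j \<le> n \<and> w j < w i}"

definition longest_perm :: "nat \<Rightarrow> nat \<Rightarrow> nat" where
  "longest_perm n i = (if i \<in> {1..n} then n + 1 - i else i)"

inductive double_schubert_rel :: "nat \<Rightarrow> (nat \<Rightarrow> nat) \<Rightarrow> xypoly \<Rightarrow> bool" for n where
  longest: "double_schubert_rel n (longest_perm n)
    (\<Prod>(i, j) \<in> {(i, j). 1 \<le> i \<and> 1 \<le> j \<and> i + j \<le> n}. xv i - yv (int j))"
| ascent: "double_schubert_rel n w (dd i f)"
    if "w permutes {1..n}" "i \<in> {1..<n}"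
      "inversions n w < inversions n (w \<circ> transpose i (Suc i))"
      "double_schubert_rel n (w \<circ> transpose i (Suc i)) f"

definition double_schubert :: "nat \<Rightarrow> (nat \<Rightarrow> nat) \<Rightarrow> xypoly" where
  "double_schubert n w = (THE f. double_schubert_rel n w f)"


section \<open>Diagrams and double orthodontia\<close>

text \<open>A diagram is a set of pairs (row, column).\<close>

definition column :: "(nat \<times> nat) set \<Rightarrow> nat \<Rightarrow> nat set" where
  "column D j = {i. (i, j) \<in> D}"

definition percent_avoiding :: "(nat \<times> nat) set \<Rightarrow> bool" where
  "percent_avoiding D \<longleftrightarrow>
    (\<forall>i1 i2 j1 j2. i1 < i2 \<and> j1 < j2 \<and> i2 \<in> column D j1 \<and> i1 \<in> column D j2 \<longrightarrow>
      i1 \<in> column D j1 \<or> i2 \<in> column D j2)"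

definition interval_columns :: "(nat \<times> nat) set \<Rightarrow> nat \<Rightarrow> nat set" where
  "interval_columns D i = {j. column D j = {1..i}}"

definition remove_columns :: "nat set \<Rightarrow> (nat \<times> nat) set \<Rightarrow> (nat \<times> nat) set" where
  "remove_columns J D = {(i, j) \<in> D. j \<notin> J}"

definition initial_diagram :: "nat \<Rightarrow> (nat \<times> nat) set \<Rightarrow> (nat \<times> nat) set" where
  "initial_diagram n D = remove_columns (\<Union>i\<in>{1..n}. interval_columns D i) D"

definition first_column :: "(nat \<times> nat) set \<Rightarrow> nat" where
  "first_column E = (LEAST j. column E j \<noteq> {})"

text \<open>For \<open>C \<subseteq> {1..n}\<close> a missing tooth automatically lies in \<open>{1..n - 1}\<close>.\<close>

definition missing_tooth :: "nat set \<Rightarrow> nat \<Rightarrow> bool" where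
  "missing_tooth C i \<longleftrightarrow> 1 \<le> i \<and> i \<notin> C \<and> Suc i \<in> C"

text \<open>The data \<open>i\<^sub>k\<close>, \<open>j\<^sub>k\<close>, \<open>E'\<close>, \<open>M\<^sub>k\<close>, \<open>E''\<close> of one orthodontic step, as functions of the
  current nonempty diagram \<open>E\<close>.\<close>

definition step_i :: "(nat \<times> nat) set \<Rightarrow> nat" where
  "step_i E = (LEAST i. missing_tooth (column E (first_column E)) i)"

definition step_j :: "(nat \<times> nat) set \<Rightarrow> int" where
  "step_j E = int (first_column E) -
    int (card {a \<in> {1..step_i E}. a \<notin> column E (first_column E)})"

definition swap_rows :: "(nat \<times> nat) set \<Rightarrow> (nat \<times> nat) set" where
  "swap_rows E = map_prod (transpose (step_i E) (Suc (step_i E))) id ` E"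

definition step_M :: "(nat \<times> nat) set \<Rightarrow> nat set" where
  "step_M E = interval_columns (swap_rows E) (step_i E)"

definition ortho_step :: "(nat \<times> nat) set \<Rightarrow> (nat \<times> nat) set" where
  "ortho_step E = remove_columns (step_M E) (swap_rows E)"

definition ortho_length :: "nat \<Rightarrow> (nat \<times> nat) set \<Rightarrow> nat" where
  "ortho_length n D = (LEAST k. (ortho_step ^^ k) (initial_diagram n D) = {})"

definition ortho_seq :: "nat \<Rightarrow> (nat \<times> nat) set \<Rightarrow> (nat \<times> int \<times> nat set) list" where
  "ortho_seq n D = map (\<lambda>k. let E = (ortho_step ^^ k) (initial_diagram n D)
      in (step_i E, step_j E, step_M E)) [0..<ortho_length n D]"

definition ortho_poly :: "nat \<Rightarrow> (nat \<times> nat) set \<Rightarrow> xypoly" where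
  "ortho_poly n D = (\<Prod>i=1..n. omega i (interval_columns D i)) *
    foldr (\<lambda>(i, j, M) f. pi_op i j (omega i M * f)) (ortho_seq n D) 1"

end

theory Submission
  imports Defs
begin

text \<open>Once the \<open>y\<close> are specialized, both families of polynomials in the proposition are built from
  \<open>1\<close> by two kinds of operations: \<open>f \<mapsto> \<partial>\<^sub>i((x\<^sub>i - 1) f)\<close>, and multiplication by a column
  \<open>(x\<^sub>1 - 1) \<cdots> (x\<^sub>i - 1)\<close>. The predicate \<open>orthodontic n r\<close> describes the polynomials obtained in
  this way with \<open>r\<close> columns. If \<open>f\<close> is one of them, put
  \<open>P = (x\<^sub>1 \<cdots> x\<^sub>n)\<^sup>r f(x\<^sub>n\<inverse>, \<dots>, x\<^sub>1\<inverse>)\<close>. Seen from \<open>P\<close>, the first operation is \<open>pi_bar (n - i)\<close>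
  (lemma \<open>reverses_demazure\<close>), and the second is multiplication by
  \<open>x\<^sub>1 \<cdots> x\<^sub>k (1 - x\<^sub>k\<^sub>+\<^sub>1) \<cdots> (1 - x\<^sub>n)\<close> with \<open>k = n - i\<close> (lemma \<open>reverses_column\<close>). Both preserve
  graded nonnegativity of \<open>P\<close>. The operator \<open>pi_bar k\<close> maps each Lascoux polynomial to a Lascoux
  polynomial with the same \<open>|\<alpha>|\<close> (lemma \<open>pi_bar_lascoux\<close>). Multiplication is the hypothesis if
  \<open>k \<ge> 1\<close>. For \<open>k = 0\<close> the factor \<open>(1 - x\<^sub>1) \<cdots> (1 - x\<^sub>n)\<close> is symmetric, hence commutes with every
  \<open>pi_bar i\<close>, so that only monomials \<open>x\<^sup>\<nu>\<close> with weakly decreasing exponents have to be treated, and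
  there the expansion is explicit (lemma \<open>lascoux_positive_partial_product\<close>).

  The signs in a graded sum refer to the lowest degree of the sum, so operators can be applied
  term by term only if that degree is known to be the least \<open>|\<alpha>|\<close> which occurs. This requires that
  the lowest-degree parts (key polynomials) of Lascoux polynomials do not cancel in a nonnegative
  combination. Key polynomials are indeed sums of monomials, but much less suffices: order
  the monomials of a fixed degree by the sum of the squares of their exponents. On the largest ones
  \<open>pi_bar i\<close> acts, in lowest degree, without negative signs and without losing the monomial with
  weakly decreasing exponents (lemma \<open>pi_bar_monomial\<close>).

  For \<open>S\<^sub>D\<close>, each step of orthodontia is one operation of the first kind after
  \<open>|M\<^sub>k|\<close> columns, and each column of \<open>D\<close> is removed at most once, so at most \<open>m\<close> columns are used
  (lemma \<open>orthodontic_ortho_poly\<close>). For \<open>S\<^sub>w\<close>, moving the smallest value of \<open>w\<close> to the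
  last position gives a recursion from \<open>n\<close> to \<open>n - 1\<close> of the same shape, with one column per step
  (lemma \<open>orthodontic_climb\<close>).

  Finally, \<open>lascoux\<close> and \<open>double_schubert\<close> select the unique value of a relation. That this value
  exists and is unique follows for both from the braid relations, by one
  confluence argument (lemma \<open>climb_ascent\<close>).\<close>


section \<open>Substitution\<close>

definition monom_eval :: "(indet \<Rightarrow> 'a::comm_ring_1) \<Rightarrow> monomial \<Rightarrow> 'a" where
  "monom_eval \<sigma> p = (\<Prod>v\<in>Poly_Mapping.keys p. \<sigma> v ^ Poly_Mapping.lookup p v)"

abbreviation mono_of :: "monomial \<Rightarrow> xypoly" where
  "mono_of p \<equiv> Poly_Mapping.single p 1"

lemma monom_eval_superset:
  assumes "finite S" "Poly_Mapping.keys p \<subseteq> S"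
  shows "monom_eval \<sigma> p = (\<Prod>v\<in>S. \<sigma> v ^ Poly_Mapping.lookup p v)"
  unfolding monom_eval_def using assms
  by (intro prod.mono_neutral_left) (auto simp: in_keys_iff)

lemma monom_eval_add: "monom_eval \<sigma> (p + q) = monom_eval \<sigma> p * monom_eval \<sigma> q"
proof -
  define S where "S = Poly_Mapping.keys p \<union> Poly_Mapping.keys q"
  have S: "finite S" by (simp add: S_def)
  have "Poly_Mapping.keys (p + q) \<subseteq> S" unfolding S_def by (rule keys_add)
  then show ?thesis
    by (simp add: monom_eval_superset [OF S] S_def lookup_add power_add prod.distrib)
qed

lemma monom_eval_0 [simp]: "monom_eval \<sigma> 0 = 1"
  by (simp add: monom_eval_def)

lemma subst_superset:
  assumes "finite S" "Poly_Mapping.keys f \<subseteq> S"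
  shows "subst \<sigma> f = (\<Sum>p\<in>S. of_int (Poly_Mapping.lookup f p) * monom_eval \<sigma> p)"
  unfolding subst_def monom_eval_def using assms
  by (intro sum.mono_neutral_left) (auto simp: in_keys_iff)

lemma subst_add [simp]: "subst \<sigma> (f + g) = subst \<sigma> f + subst \<sigma> g"
proof -
  define S where "S = Poly_Mapping.keys f \<union> Poly_Mapping.keys g"
  have S: "finite S" by (simp add: S_def)
  have "Poly_Mapping.keys (f + g) \<subseteq> S" unfolding S_def by (rule keys_add)
  then show ?thesis
    by (simp add: subst_superset [OF S] S_def lookup_add distrib_right sum.distrib)
qed

lemma subst_0 [simp]: "subst \<sigma> 0 = 0"
  by (simp add: subst_def)

lemma subst_single: "subst \<sigma> (Poly_Mapping.single p c) = of_int c * monom_eval \<sigma> p"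
  by (cases "c = 0") (simp_all add: subst_def monom_eval_def)

lemma subst_1 [simp]: "subst \<sigma> 1 = 1"
  using subst_single [of \<sigma> 0 1] by simp

lemma subst_var [simp]: "subst \<sigma> (var v) = \<sigma> v"
  by (simp add: var_def subst_single monom_eval_def)

lemma subst_sum [simp]: "subst \<sigma> (sum f A) = (\<Sum>x\<in>A. subst \<sigma> (f x))"
  by (induction A rule: infinite_finite_induct) simp_all

lemma subst_uminus [simp]: "subst \<sigma> (- f) = - subst \<sigma> f"
  by (metis add.inverse_unique add.right_inverse subst_0 subst_add)

lemma subst_diff [simp]: "subst \<sigma> (f - g) = subst \<sigma> f - subst \<sigma> g"
  by (metis diff_conv_add_uminus subst_add subst_uminus)

lemma sum_monomials:
  "(\<Sum>p\<in>Poly_Mapping.keys f. Poly_Mapping.single p (Poly_Mapping.lookup f p)) = f"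
proof (rule poly_mapping_eqI)
  fix k
  show "Poly_Mapping.lookup (\<Sum>p\<in>Poly_Mapping.keys f.
      Poly_Mapping.single p (Poly_Mapping.lookup f p)) k = Poly_Mapping.lookup f k"
    by (simp add: lookup_sum lookup_single when_def in_keys_iff)
qed

lemma subst_mult [simp]: "subst \<sigma> (f * g) = subst \<sigma> f * subst \<sigma> g"
proof -
  have single: "subst \<sigma> (Poly_Mapping.single p c * Poly_Mapping.single q d) =
      subst \<sigma> (Poly_Mapping.single p c) * subst \<sigma> (Poly_Mapping.single q d)" for p c q d
    by (simp add: mult_single subst_single monom_eval_add)
  have "subst \<sigma> (Poly_Mapping.single p c * g) = subst \<sigma> (Poly_Mapping.single p c) * subst \<sigma> g"
    for p c
    by (subst (1 2) sum_monomials [of g, symmetric])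
      (simp add: sum_distrib_left single)
  then show ?thesis
    by (subst (1 2) sum_monomials [of f, symmetric]) (simp add: sum_distrib_right)
qed

lemma subst_power [simp]: "subst \<sigma> (f ^ k) = subst \<sigma> f ^ k"
  by (induction k) simp_all

lemma subst_prod [simp]: "subst \<sigma> (prod f A) = (\<Prod>x\<in>A. subst \<sigma> (f x))"
  by (induction A rule: infinite_finite_induct) simp_all

lemma subst_of_int [simp]: "subst \<sigma> (of_int c) = of_int c"
  using subst_single [of \<sigma> 0 c]
  by (metis single_of_int of_int_eq_id id_apply monom_eval_0 mult.right_neutral)

lemma subst_comp: "subst \<tau> (subst \<sigma> f) = subst (\<lambda>v. subst \<tau> (\<sigma> v)) f"
  unfolding subst_def [of \<sigma>] subst_def [of "\<lambda>v. subst \<tau> (\<sigma> v)"] by simp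

lemma to_fract_prod: "to_fract (prod f A) = (\<Prod>x\<in>A. to_fract (f x))"
  by (induction A rule: infinite_finite_induct) simp_all

lemma to_fract_power: "to_fract (a ^ k) = to_fract a ^ k"
  by (induction k) simp_all

lemma to_fract_of_int: "to_fract (of_int c) = of_int c"
  by (induction c rule: int_induct [where k = 0]) simp_all

text \<open>Evaluating at the variables inside the field of fractions recovers the polynomial; this is how
  statements about all evaluation points return to \<open>xypoly\<close>.\<close>

lemma subst_to_fract: "subst (\<lambda>v. to_fract (\<sigma> v)) f = to_fract (subst \<sigma> f)"
  by (simp add: subst_def to_fract_sum to_fract_prod to_fract_power to_fract_of_int)

text \<open>Composition of renamings is composition of index maps, which reduces the relations between
  the \<open>swap_vars i\<close> to those between transpositions.\<close>

definition rename :: "(nat \<Rightarrow> nat) \<Rightarrow> xypoly \<Rightarrow> xypoly" where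
  "rename g = subst (\<lambda>v. case v of X k \<Rightarrow> xv (g k) | Y j \<Rightarrow> yv j)"

lemma swap_vars_rename: "swap_vars i = rename (transpose i (Suc i))"
  by (simp add: swap_vars_def rename_def)

lemma rename_rename: "rename g (rename h f) = rename (\<lambda>k. g (h k)) f"
  unfolding rename_def subst_comp
  by (intro arg_cong [where f = "\<lambda>\<sigma>. subst \<sigma> f"] ext) (simp split: indet.splits)

lemma rename_id: "rename (\<lambda>k. k) f = f"
proof -
  have "(\<lambda>v. case v of X k \<Rightarrow> xv k | Y j \<Rightarrow> yv j) = var"
    by (auto split: indet.splits)
  then show ?thesis by (simp add: rename_def subst_var_self)
qed

lemma rename_hom [simp]:
  "rename g (f1 + f2) = rename g f1 + rename g f2" "rename g (f1 - f2) = rename g f1 - rename g f2"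
  "rename g (f1 * f2) = rename g f1 * rename g f2" "rename g (- f1) = - rename g f1"
  "rename g 1 = 1" "rename g 0 = 0" "rename g (of_int c) = of_int c" "rename g (f1 ^ k) = rename g f1 ^ k"
  "rename g (prod F A) = (\<Prod>x\<in>A. rename g (F x))" "rename g (xv j) = xv (g j)"
  "rename g (yv l) = yv l"
  by (simp_all add: rename_def)

lemma swap_hom [simp]:
  "swap_vars i (f1 + f2) = swap_vars i f1 + swap_vars i f2"
  "swap_vars i (f1 - f2) = swap_vars i f1 - swap_vars i f2"
  "swap_vars i (f1 * f2) = swap_vars i f1 * swap_vars i f2" "swap_vars i (- f1) = - swap_vars i f1"
  "swap_vars i 1 = 1" "swap_vars i 0 = 0" "swap_vars i (of_int c) = of_int c"
  "swap_vars i (f1 ^ k) = swap_vars i f1 ^ k"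
  "swap_vars i (prod F A) = (\<Prod>x\<in>A. swap_vars i (F x))"
  "swap_vars i (xv j) = xv (transpose i (Suc i) j)" "swap_vars i (yv l) = yv l"
  by (simp_all add: swap_vars_rename)

lemma swap_swap [simp]: "swap_vars i (swap_vars i f) = f"
  by (simp add: swap_vars_rename rename_rename rename_id)

lemma swap_commute:
  assumes "Suc i < j"
  shows "swap_vars i (swap_vars j f) = swap_vars j (swap_vars i f)"
proof -
  have "(\<lambda>k. transpose i (Suc i) (transpose j (Suc j) k)) =
      (\<lambda>k. transpose j (Suc j) (transpose i (Suc i) k))"
    using assms by (auto simp: transpose_def)
  then show ?thesis by (simp add: swap_vars_rename rename_rename)
qed

lemma swap_braid:
  "swap_vars i (swap_vars (Suc i) (swap_vars i f)) =
   swap_vars (Suc i) (swap_vars i (swap_vars (Suc i) f))"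
proof -
  have "(\<lambda>k. transpose i (Suc i) (transpose (Suc i) (Suc (Suc i)) (transpose i (Suc i) k))) =
      (\<lambda>k. transpose (Suc i) (Suc (Suc i)) (transpose i (Suc i) (transpose (Suc i) (Suc (Suc i)) k)))"
    by (auto simp: transpose_def)
  then show ?thesis by (simp add: swap_vars_rename rename_rename)
qed


section \<open>Divided differences\<close>

lemma xv_eq_iff [simp]: "xv i = xv j \<longleftrightarrow> i = j"
  by (auto simp: var_def dest!: arg_cong [where f = Poly_Mapping.keys])

lemma dd_eq: "(xv i - xv (Suc i)) * dd i f = f - swap_vars i f"
  unfolding dd_def by (rule theI' [OF divided_difference])

lemma dd_eqI: "(xv i - xv (Suc i)) * g = f - swap_vars i f \<Longrightarrow> dd i f = g"
  using dd_eq [of i f] divided_difference [of i f] by metis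

lemma dd_add: "dd i (f + g) = dd i f + dd i g"
  by (rule dd_eqI) (simp add: distrib_left dd_eq)

lemma dd_mult_sym:
  assumes "swap_vars i g = g"
  shows "dd i (g * f) = g * dd i f"
  by (rule dd_eqI) (simp add: assms mult.left_commute [of _ g] dd_eq right_diff_distrib)

lemma swap_dd: "swap_vars i (dd i f) = dd i f"
proof -
  have "(xv (Suc i) - xv i) * swap_vars i (dd i f) = swap_vars i ((xv i - xv (Suc i)) * dd i f)"
    by simp
  also have "\<dots> = - ((xv i - xv (Suc i)) * dd i f)"
    by (simp only: dd_eq) simp
  finally have "(xv (Suc i) - xv i) * swap_vars i (dd i f) = - ((xv i - xv (Suc i)) * dd i f)" .
  then have "(xv i - xv (Suc i)) * swap_vars i (dd i f) = (xv i - xv (Suc i)) * dd i f"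
    by (simp add: algebra_simps)
  then show ?thesis by simp
qed


section \<open>Braid relations\<close>

text \<open>With \<open>s1\<close> and \<open>s2\<close> acting as the adjacent transpositions of \<open>x, y, z\<close> and \<open>A = x - y\<close>,
  \<open>B = y - z\<close>, \<open>C = x - z\<close>, the left-hand side of the braid relation becomes a signed sum over the
  six elements of the symmetric group. Exchanging the roles of \<open>s1\<close> and \<open>s2\<close> gives the same
  sum. The identity \<open>key\<close> is what makes the coefficients of \<open>f\<close> and \<open>s1 f\<close> divisible by \<open>A\<close>.\<close>

lemma braid_expansion:
  fixes f :: "'a::idom" and s1 s2 T1 T2 :: "'a \<Rightarrow> 'a"
  assumes s1_hom: "\<And>p q. s1 (p * q) = s1 p * s1 q" "\<And>p q. s1 (p - q) = s1 p - s1 q" "\<And>p. s1 (s1 p) = p"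
    and s2_hom: "\<And>p q. s2 (p * q) = s2 p * s2 q" "\<And>p q. s2 (p - q) = s2 p - s2 q"
    and T1: "\<And>f. A * T1 f = a * f - a' * s1 f"
    and T2: "\<And>f. B * T2 f = b * f - b' * s2 f"
    and s1: "s1 A = - A" "s1 B = C" "s1 C = B" "s1 a = a'" "s1 a' = a"
      "s1 b = c" "s1 c = b" "s1 b' = c'" "s1 c' = b'"
    and s2: "s2 A = C" "s2 a = c" "s2 a' = c'"
    and key: "a * b * C - a' * c * B = A * b * c"
    and A: "A \<noteq> 0"
  shows "A * B * C * T1 (T2 (T1 f)) =
    a * b * c * f - a' * b * c * s1 f - a * b' * c * s2 f
    + a * b' * c' * s2 (s1 f) + a' * b * c' * s1 (s2 f) - a' * b' * c' * s1 (s2 (s1 f))"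
    (is "_ = ?R")
proof -
  define g where "g = T1 f"
  define h where "h = T2 g"
  have "C * s2 g = s2 (A * g)" by (simp add: s2_hom s2)
  also have "\<dots> = c * s2 f - c' * s2 (s1 f)" by (simp add: g_def T1 s2_hom s2)
  finally have e2: "C * s2 g = c * s2 f - c' * s2 (s1 f)" .
  have "A * B * C * h = A * C * (B * h)" by (simp add: ac_simps)
  also have "\<dots> = C * b * (A * g) - A * b' * (C * s2 g)"
    by (simp only: h_def T2) (simp add: algebra_simps)
  also have "A * g = a * f - a' * s1 f" by (simp add: g_def T1)
  also note e2
  finally have e4: "A * B * C * h =
    C * b * (a * f - a' * s1 f) - A * b' * (c * s2 f - c' * s2 (s1 f))" .
  have "- (A * B * C * s1 h) = s1 (A * B * C * h)" by (simp add: s1_hom s1)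
  also have "\<dots> = B * c * (a' * s1 f - a * f) + A * c' * (b * s1 (s2 f) - b' * s1 (s2 (s1 f)))"
    by (simp add: e4 s1_hom s1)
  finally have e5: "- (A * B * C * s1 h) =
    B * c * (a' * s1 f - a * f) + A * c' * (b * s1 (s2 f) - b' * s1 (s2 (s1 f)))" .
  have "A * (A * B * C * T1 h) = A * B * C * (A * T1 h)" by (simp add: ac_simps)
  also have "\<dots> = a * (A * B * C * h) + a' * (- (A * B * C * s1 h))"
    by (simp only: T1) (simp add: algebra_simps)
  also have "\<dots> = (a * b * C - a' * c * B) * (a * f - a' * s1 f)
    + A * (a' * c' * (b * s1 (s2 f) - b' * s1 (s2 (s1 f))) - a * b' * (c * s2 f - c' * s2 (s1 f)))"
    unfolding e4 e5 by (simp add: algebra_simps)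
  also have "\<dots> = A * ?R"
    unfolding key by (simp add: algebra_simps)
  finally show ?thesis using A by (simp add: h_def g_def)
qed

text \<open>The operators \<open>\<partial>\<^sub>i\<close> and \<open>pi_bar i\<close> are both of the form \<open>f \<mapsto> \<partial>\<^sub>i(h(x\<^sub>i, x\<^sub>i\<^sub>+\<^sub>1) f)\<close>; the last two
  conditions are the hypothesis \<open>key\<close> above for the two sides of the braid relation.\<close>

locale braid_kernel =
  fixes h :: "xypoly \<Rightarrow> xypoly \<Rightarrow> xypoly"
  assumes rename_h: "rename g (h p q) = h (rename g p) (rename g q)"
    and key1: "h x y * h y z * (x - z) - h y x * h x z * (y - z) = (x - y) * h y z * h x z"
    and key2: "h y z * h x y * (x - z) - h z y * h x z * (x - y) = (y - z) * h x y * h x z"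
begin

definition T :: "nat \<Rightarrow> xypoly \<Rightarrow> xypoly" where
  "T i f = dd i (h (xv i) (xv (Suc i)) * f)"

lemma swap_h: "swap_vars j (h p q) = h (swap_vars j p) (swap_vars j q)"
  by (simp only: swap_vars_rename rename_h)

lemma T_eq: "(xv i - xv (Suc i)) * T i f =
    h (xv i) (xv (Suc i)) * f - h (xv (Suc i)) (xv i) * swap_vars i f"
  by (simp add: T_def dd_eq swap_h)

lemma T_braid: "T i (T (Suc i) (T i f)) = T (Suc i) (T i (T (Suc i) f))"
proof -
  let ?x = "xv i" and ?y = "xv (Suc i)" and ?z = "xv (Suc (Suc i))"
  let ?s = "swap_vars i" and ?t = "swap_vars (Suc i)"
  have l: "(?x - ?y) * (?y - ?z) * (?x - ?z) * T i (T (Suc i) (T i f)) =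
    h ?x ?y * h ?y ?z * h ?x ?z * f - h ?y ?x * h ?y ?z * h ?x ?z * ?s f
      - h ?x ?y * h ?z ?y * h ?x ?z * ?t f
      + h ?x ?y * h ?z ?y * h ?z ?x * ?t (?s f) + h ?y ?x * h ?y ?z * h ?z ?x * ?s (?t f)
      - h ?y ?x * h ?z ?y * h ?z ?x * ?s (?t (?s f))"
    by (rule braid_expansion) (simp_all add: T_eq swap_h key1)
  have r: "(?y - ?z) * (?x - ?y) * (?x - ?z) * T (Suc i) (T i (T (Suc i) f)) =
    h ?y ?z * h ?x ?y * h ?x ?z * f - h ?z ?y * h ?x ?y * h ?x ?z * ?t f
      - h ?y ?z * h ?y ?x * h ?x ?z * ?s f
      + h ?y ?z * h ?y ?x * h ?z ?x * ?s (?t f) + h ?z ?y * h ?x ?y * h ?z ?x * ?t (?s f)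
      - h ?z ?y * h ?y ?x * h ?z ?x * ?t (?s (?t f))"
    by (rule braid_expansion) (simp_all add: T_eq swap_h key2)
  have "(?x - ?y) * (?y - ?z) * (?x - ?z) * T i (T (Suc i) (T i f)) =
    (?x - ?y) * (?y - ?z) * (?x - ?z) * T (Suc i) (T i (T (Suc i) f))"
    unfolding mult.commute [of "?x - ?y" "?y - ?z"] r unfolding mult.commute [of "?y - ?z" "?x - ?y"] l
    by (simp add: swap_braid ac_simps)
  then show ?thesis by simp
qed

lemma T_commute:
  assumes "Suc i < j"
  shows "T i (T j f) = T j (T i f)"
proof -
  let ?A = "xv i - xv (Suc i)" and ?B = "xv j - xv (Suc j)"
  have s: "swap_vars i (xv j) = xv j" "swap_vars i (xv (Suc j)) = xv (Suc j)"
    "swap_vars j (xv i) = xv i" "swap_vars j (xv (Suc i)) = xv (Suc i)"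
    using assms by (simp_all add: transpose_def)
  have i: "?B * swap_vars i (T j f) = swap_vars i (?B * T j f)" by (simp only: swap_hom(2,3) s)
  have j: "?A * swap_vars j (T i f) = swap_vars j (?A * T i f)" by (simp only: swap_hom(2,3) s)
  have "?A * (?B * T i (T j f)) = ?B * (?A * T i (T j f))" by (simp only: mult.left_commute)
  also have "\<dots> = h (xv i) (xv (Suc i)) * (?B * T j f)
      - h (xv (Suc i)) (xv i) * (?B * swap_vars i (T j f))"
    unfolding T_eq [of i] by (simp add: algebra_simps)
  also have "\<dots> = h (xv j) (xv (Suc j)) * (?A * T i f)
      - h (xv (Suc j)) (xv j) * (?A * swap_vars j (T i f))"
    unfolding i j T_eq by (simp add: swap_h s swap_commute [OF assms] del: swap_hom(10)) (simp add: algebra_simps)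
  also have "\<dots> = ?A * (?B * T j (T i f))"
    unfolding T_eq [of j] by (simp add: algebra_simps)
  finally show ?thesis using assms by simp
qed

end

interpretation dd: braid_kernel "\<lambda>_ _. 1"
  rewrites "dd.T = dd"
proof -
  show *: "braid_kernel (\<lambda>_ _. 1)" by standard simp_all
  show "braid_kernel.T (\<lambda>_ _. 1) = dd" by (intro ext) (simp add: braid_kernel.T_def [OF *])
qed

interpretation pi_bar: braid_kernel "\<lambda>p q. (1 - q) * p"
  rewrites "pi_bar.T = pi_bar"
proof -
  show *: "braid_kernel (\<lambda>p q. (1 - q) * p)" by standard (simp_all add: algebra_simps)
  show "braid_kernel.T (\<lambda>p q. (1 - q) * p) = pi_bar"
    by (intro ext) (simp add: braid_kernel.T_def [OF *] pi_bar_def dd_bar_def mult.assoc)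
qed


section \<open>Climbing to the dominant element\<close>

text \<open>The termination measure of the climb from \<open>u\<close> to a weakly decreasing sequence.\<close>

lemma weighted_sum_swap:
  fixes u :: "nat \<Rightarrow> nat"
  assumes "i \<in> {1..<n}" "u i < u (Suc i)"
  shows "(\<Sum>k=1..n. k * (u \<circ> transpose i (Suc i)) k) < (\<Sum>k=1..n. k * u k)"
proof -
  have *: "(\<Sum>k=1..n. f k) = f i + f (Suc i) + (\<Sum>k\<in>{1..n} - {i, Suc i}. f k)" for f :: "nat \<Rightarrow> nat"
  proof -
    have "(\<Sum>k=1..n. f k) = sum f {i, Suc i} + sum f ({1..n} - {i, Suc i})"
      using assms(1) by (subst add.commute, intro sum.subset_diff) auto
    then show ?thesis by simp
  qed
  have "(\<Sum>k\<in>{1..n} - {i, Suc i}. k * (u \<circ> transpose i (Suc i)) k) =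
      (\<Sum>k\<in>{1..n} - {i, Suc i}. k * u k)"
    by (intro sum.cong) (auto simp: transpose_def)
  with assms(2) show ?thesis unfolding * by simp
qed

lemma climb_induct [case_names dominant ascent]:
  assumes "\<And>u. (\<And>i. i \<in> {1..<n} \<Longrightarrow> u (Suc i) \<le> u i) \<Longrightarrow> P u"
    and "\<And>u i. i \<in> {1..<n} \<Longrightarrow> u i < u (Suc i) \<Longrightarrow> P (u \<circ> transpose i (Suc i)) \<Longrightarrow> P u"
  shows "P (u :: nat \<Rightarrow> nat)"
proof (induction "\<Sum>k=1..n. k * u k" arbitrary: u rule: less_induct)
  case less
  show ?case
  proof (cases "\<exists>i\<in>{1..<n}. u i < u (Suc i)")
    case True
    then obtain i where i: "i \<in> {1..<n}" "u i < u (Suc i)" by blast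
    then show ?thesis using weighted_sum_swap [OF i] by (intro assms(2) [OF i] less.hyps)
  next
    case False
    then show ?thesis by (intro assms(1)) (auto simp: not_less)
  qed
qed

text \<open>A function satisfying the recursion of \<open>lascoux_rel\<close> and \<open>double_schubert_rel\<close>, with the least
  ascent as an arbitrary choice; by \<open>climb_ascent\<close> the choice does not matter.\<close>

function climb :: "(nat \<Rightarrow> xypoly \<Rightarrow> xypoly) \<Rightarrow> ((nat \<Rightarrow> nat) \<Rightarrow> xypoly) \<Rightarrow> nat \<Rightarrow> (nat \<Rightarrow> nat) \<Rightarrow> xypoly" where
  "climb T b n u =
    (if \<exists>i. i \<in> {1..<n} \<and> u i < u (Suc i)
     then let i = (LEAST i. i \<in> {1..<n} \<and> u i < u (Suc i)) in T i (climb T b n (u \<circ> transpose i (Suc i)))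
     else b u)"
  by auto
termination
proof (relation "measure (\<lambda>(T, b, n, u). \<Sum>k=1..n. k * u k)", goal_cases)
  case (2 T b n u x)
  then have "x \<in> {1..<n} \<and> u x < u (Suc x)" by (auto intro: LeastI2_ex)
  then show ?case using weighted_sum_swap [of x n u] by simp
qed auto

declare climb.simps [simp del]

lemma climb_dominant:
  assumes "\<And>i. i \<in> {1..<n} \<Longrightarrow> u (Suc i) \<le> u i"
  shows "climb T b n u = b u"
proof -
  have "\<not> (\<exists>i. i \<in> {1..<n} \<and> u i < u (Suc i))" using assms not_less by blast
  then show ?thesis by (subst climb.simps) (simp only: if_False)
qed

text \<open>Local confluence: two different ascents of \<open>u\<close> are either far apart, and the operators
  commute, or adjacent, and then \<open>u\<close> increases along three consecutive positions, so that both ways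
  continue to the same sequence by the two sides of the braid relation.\<close>

lemma (in braid_kernel) climb_ascent:
  assumes "i \<in> {1..<n}" "u i < u (Suc i)"
  shows "climb T b n u = T i (climb T b n (u \<circ> transpose i (Suc i)))"
  using assms
proof (induction "\<Sum>k=1..n. k * u k" arbitrary: u i rule: less_induct)
  case less
  let ?L = "climb T b n" and ?P = "\<lambda>i. i \<in> {1..<n} \<and> u i < u (Suc i)"
  let ?s = "\<lambda>i. transpose i (Suc i)"
  define i0 where "i0 = (LEAST i. ?P i)"
  have i: "?P i" using less.prems by simp
  have i0: "?P i0" unfolding i0_def by (rule LeastI [of ?P, OF i])
  have "i0 \<le> i" unfolding i0_def by (rule Least_le [of ?P, OF i])
  have L: "?L u = T i0 (?L (u \<circ> ?s i0))"
    using i by (subst climb.simps) (auto simp: i0_def Let_def)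
  have IH: "?L v = T j (?L (v \<circ> ?s j))"
    if "(\<Sum>k=1..n. k * v k) < (\<Sum>k=1..n. k * u k)" "j \<in> {1..<n}" "v j < v (Suc j)" for v j
    using less.hyps that by blast
  have w: "(\<Sum>k=1..n. k * (u \<circ> ?s j) k) < (\<Sum>k=1..n. k * u k)" if "?P j" for j
    using weighted_sum_swap that by blast
  consider "i = i0" | "i = Suc i0" | "Suc i0 < i" using \<open>i0 \<le> i\<close> by linarith
  then show ?case
  proof cases
    case 1 then show ?thesis using L by simp
  next
    case 3
    have a: "?L (u \<circ> ?s i0) = T i (?L (u \<circ> ?s i0 \<circ> ?s i))"
      using i 3 by (intro IH w i0) (auto simp: transpose_def)
    have b: "?L (u \<circ> ?s i) = T i0 (?L (u \<circ> ?s i \<circ> ?s i0))"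
      using i0 3 by (intro IH w i) (auto simp: transpose_def)
    have "u \<circ> ?s i0 \<circ> ?s i = u \<circ> ?s i \<circ> ?s i0" using 3 by (auto simp: transpose_def)
    then show ?thesis using L a b T_commute [OF 3] by simp
  next
    case 2
    have lt: "u i0 < u (Suc i0)" "u (Suc i0) < u (Suc (Suc i0))"
      and n: "i0 \<in> {1..<n}" "Suc i0 \<in> {1..<n}" using i i0 2 by auto
    have a: "?L (u \<circ> ?s i0) = T i (?L (u \<circ> ?s i0 \<circ> ?s i))"
      using lt n 2 by (intro IH w i0) (auto simp: transpose_def)
    have wa: "(\<Sum>k=1..n. k * (u \<circ> ?s i0 \<circ> ?s i) k) < (\<Sum>k=1..n. k * u k)"
      using lt n 2 by (intro order.strict_trans [OF weighted_sum_swap w [OF i0]]) (auto simp: transpose_def)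
    have a': "?L (u \<circ> ?s i0 \<circ> ?s i) = T i0 (?L (u \<circ> ?s i0 \<circ> ?s i \<circ> ?s i0))"
      using lt n 2 by (intro IH wa) (auto simp: transpose_def)
    have b: "?L (u \<circ> ?s i) = T i0 (?L (u \<circ> ?s i \<circ> ?s i0))"
      using lt n 2 by (intro IH w i) (auto simp: transpose_def)
    have wb: "(\<Sum>k=1..n. k * (u \<circ> ?s i \<circ> ?s i0) k) < (\<Sum>k=1..n. k * u k)"
      using lt n 2 by (intro order.strict_trans [OF weighted_sum_swap w [OF i]]) (auto simp: transpose_def)
    have b': "?L (u \<circ> ?s i \<circ> ?s i0) = T i (?L (u \<circ> ?s i \<circ> ?s i0 \<circ> ?s i))"
      using lt n 2 by (intro IH wb) (auto simp: transpose_def)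
    have "u \<circ> ?s i0 \<circ> ?s i \<circ> ?s i0 = u \<circ> ?s i \<circ> ?s i0 \<circ> ?s i"
      unfolding 2 by (intro ext) (auto simp: transpose_def)
    then show ?thesis using L a a' b b' T_braid [of i0] 2 by simp
  qed
qed


section \<open>Lascoux polynomials\<close>

lemma compositions_swap:
  assumes "\<alpha> \<in> compositions n" "i \<in> {1..<n}"
  shows "\<alpha> \<circ> transpose i (Suc i) \<in> compositions n"
  using assms by (auto simp: compositions_def transpose_def)

lemma composition_induct [consumes 1, case_names dominant ascent]:
  assumes "\<alpha> \<in> compositions n"
    and "\<And>\<alpha>. \<alpha> \<in> compositions n \<Longrightarrow> (\<And>i. i \<in> {1..<n} \<Longrightarrow> \<alpha> (Suc i) \<le> \<alpha> i) \<Longrightarrow> P \<alpha>"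
    and "\<And>\<alpha> i. \<alpha> \<in> compositions n \<Longrightarrow> i \<in> {1..<n} \<Longrightarrow> \<alpha> i < \<alpha> (Suc i) \<Longrightarrow>
      P (\<alpha> \<circ> transpose i (Suc i)) \<Longrightarrow> P \<alpha>"
  shows "P \<alpha>"
proof -
  have "\<alpha> \<in> compositions n \<longrightarrow> P \<alpha>"
  proof (induction \<alpha> rule: climb_induct [of n])
    case (dominant \<alpha>)
    then show ?case using assms(2) [of \<alpha>] by blast
  next
    case (ascent \<alpha> i)
    then show ?case using assms(3) [of \<alpha> i] compositions_swap [of \<alpha> n i] by blast
  qed
  then show ?thesis using assms(1) by blast
qed

lemma weight_swap:
  assumes "i \<in> {1..<n}"
  shows "weight n (\<alpha> \<circ> transpose i (Suc i)) = weight n \<alpha>"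
proof -
  have "transpose i (Suc i) permutes {1..n}"
    using assms by (intro permutes_swap_id) auto
  then have "sum \<alpha> {1..n} = sum (\<alpha> \<circ> transpose i (Suc i)) {1..n}"
    by (rule sum.permute)
  then show ?thesis by (simp add: weight_def)
qed

lemma lascoux_climb:
  assumes "\<alpha> \<in> compositions n"
  shows "lascoux n \<alpha> = climb pi_bar (\<lambda>\<alpha>. \<Prod>i=1..n. xv i ^ \<alpha> i) n \<alpha>" (is "_ = ?L \<alpha>")
  unfolding lascoux_def
proof (rule the_equality)
  show "lascoux_rel n \<alpha> (?L \<alpha>)"
    using assms
  proof (induction rule: composition_induct)
    case (dominant \<alpha>)
    have "?L \<alpha> = (\<Prod>i=1..n. xv i ^ \<alpha> i)" by (rule climb_dominant) (rule dominant(2))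
    then show ?case using lascoux_rel.dominant [OF dominant] by simp
  next
    case (ascent \<alpha> i)
    show ?case
      unfolding pi_bar.climb_ascent [of i n \<alpha>, OF ascent(2,3)]
      by (rule lascoux_rel.ascent [OF ascent])
  qed
next
  fix f assume "lascoux_rel n \<alpha> f"
  then show "f = ?L \<alpha>"
  proof induction
    case (dominant \<alpha>)
    then show ?case by (intro climb_dominant [symmetric])
  next
    case (ascent \<alpha> i f)
    show ?case unfolding ascent.IH by (rule pi_bar.climb_ascent [symmetric]) fact+
  qed
qed

lemma lascoux_dominant:
  assumes "\<alpha> \<in> compositions n" "\<And>i. i \<in> {1..<n} \<Longrightarrow> \<alpha> (Suc i) \<le> \<alpha> i"
  shows "lascoux n \<alpha> = (\<Prod>i=1..n. xv i ^ \<alpha> i)"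
  unfolding lascoux_climb [OF assms(1)] by (rule climb_dominant) (rule assms(2))

lemma lascoux_ascent:
  assumes "\<alpha> \<in> compositions n" "i \<in> {1..<n}" "\<alpha> i < \<alpha> (Suc i)"
  shows "lascoux n \<alpha> = pi_bar i (lascoux n (\<alpha> \<circ> transpose i (Suc i)))"
  using pi_bar.climb_ascent [of i n \<alpha>] assms compositions_swap [of \<alpha> n i]
  by (simp add: lascoux_climb)

lemma pi_bar_add: "pi_bar i (f + g) = pi_bar i f + pi_bar i g"
  by (simp add: pi_bar_def dd_bar_def distrib_left dd_add)

lemma pi_bar_mult_sym:
  assumes "swap_vars i g = g"
  shows "pi_bar i (g * f) = g * pi_bar i f"
  using dd_mult_sym [OF assms, of "(1 - xv (Suc i)) * (xv i * f)"]
  by (simp add: pi_bar_def dd_bar_def ac_simps)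

lemma pi_bar_of_int: "pi_bar i (of_int c * f) = of_int c * pi_bar i f"
  by (rule pi_bar_mult_sym) simp

lemma pi_bar_0 [simp]: "pi_bar i 0 = 0"
  using pi_bar_of_int [of i 0 0] by simp

lemma pi_bar_1: "pi_bar i 1 = 1"
  by (simp add: pi_bar_def dd_bar_def) (rule dd_eqI, simp add: algebra_simps)

lemma pi_bar_sum: "pi_bar i (sum f A) = (\<Sum>x\<in>A. pi_bar i (f x))"
  by (induction A rule: infinite_finite_induct) (simp_all add: pi_bar_add)

lemma swap_pi_bar [simp]: "swap_vars i (pi_bar i f) = pi_bar i f"
  by (simp add: pi_bar_def dd_bar_def swap_dd)

lemma pi_bar_sym: "swap_vars i f = f \<Longrightarrow> pi_bar i f = f"
  using pi_bar_mult_sym [of i f 1] by (simp add: pi_bar_1)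

text \<open>The symmetry in \<open>x\<^sub>k, x\<^sub>k\<^sub>+\<^sub>1\<close> that an equality \<open>\<alpha> k = \<alpha> (Suc k)\<close> suggests is visible for weakly
  decreasing \<open>\<alpha>\<close>. It propagates along an ascent \<open>i\<close>: if \<open>i\<close> is not adjacent to \<open>k\<close>, the operators
  commute; if it is, the two equal entries are moved past the third one by two operators, and the
  braid relation transfers the symmetry at the new position of the equal entries back to \<open>k\<close>.\<close>

lemma pi_bar_lascoux_level:
  assumes "\<alpha> \<in> compositions n" "k \<in> {1..<n}" "\<alpha> k = \<alpha> (Suc k)"
  shows "pi_bar k (lascoux n \<alpha>) = lascoux n \<alpha>"
  using assms
proof (induction "\<Sum>k=1..n. k * \<alpha> k" arbitrary: \<alpha> k rule: less_induct)
  case less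
  let ?s = "\<lambda>i. transpose i (Suc i)"
  note \<alpha> = less.prems(1) and k = less.prems(2) and eq = less.prems(3)
  show ?case
  proof (cases "\<exists>i\<in>{1..<n}. \<alpha> i < \<alpha> (Suc i)")
    case False
    have "swap_vars k (\<Prod>i=1..n. xv i ^ \<alpha> i) = (\<Prod>i=1..n. (\<lambda>i. xv i ^ \<alpha> i) (?s k i))"
      using eq by (auto simp: transpose_def intro!: prod.cong)
    also have "\<dots> = (\<Prod>i=1..n. xv i ^ \<alpha> i)"
      using prod.permute [of "?s k" "{1..n}" "\<lambda>i. xv i ^ \<alpha> i"] k
      by (simp add: permutes_swap_id o_def)
    finally show ?thesis
      using lascoux_dominant [OF \<alpha>] False by (intro pi_bar_sym) (auto simp: not_less)
  next
    case True
    then obtain i where i: "i \<in> {1..<n}" "\<alpha> i < \<alpha> (Suc i)" by blast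
    define \<beta> where "\<beta> = \<alpha> \<circ> ?s i"
    have \<beta>: "\<beta> \<in> compositions n" unfolding \<beta>_def using \<alpha> i(1) by (rule compositions_swap)
    have w\<beta>: "(\<Sum>k=1..n. k * \<beta> k) < (\<Sum>k=1..n. k * \<alpha> k)"
      unfolding \<beta>_def using i by (rule weighted_sum_swap)
    have L\<alpha>: "lascoux n \<alpha> = pi_bar i (lascoux n \<beta>)"
      unfolding \<beta>_def using \<alpha> i by (rule lascoux_ascent)
    have "i \<noteq> k" using i eq by auto
    then consider "Suc i < k \<or> Suc k < i" | "k = Suc i" | "i = Suc k" by linarith
    then show ?thesis
    proof cases
      case 1
      then have "pi_bar k (lascoux n \<beta>) = lascoux n \<beta>"
        using k eq by (intro less.hyps w\<beta> \<beta>) (auto simp: \<beta>_def transpose_def)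
      moreover have "pi_bar k (pi_bar i f) = pi_bar i (pi_bar k f)" for f
        using 1 pi_bar.T_commute by metis
      ultimately show ?thesis by (simp add: L\<alpha>)
    next
      case 2
      define \<gamma> where "\<gamma> = \<beta> \<circ> ?s k"
      have lt: "\<beta> k < \<beta> (Suc k)" using i eq unfolding 2 \<beta>_def by (simp add: transpose_def)
      have \<gamma>: "\<gamma> \<in> compositions n" unfolding \<gamma>_def using \<beta> k by (rule compositions_swap)
      have w\<gamma>: "(\<Sum>k=1..n. k * \<gamma> k) < (\<Sum>k=1..n. k * \<alpha> k)"
        unfolding \<gamma>_def by (rule order.strict_trans [OF weighted_sum_swap [OF k lt] w\<beta>])
      have L\<beta>: "lascoux n \<beta> = pi_bar k (lascoux n \<gamma>)"
        unfolding \<gamma>_def using \<beta> k lt by (rule lascoux_ascent)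
      have "pi_bar i (lascoux n \<gamma>) = lascoux n \<gamma>"
        using eq i(1) by (intro less.hyps w\<gamma> \<gamma>) (auto simp: \<gamma>_def \<beta>_def transpose_def 2)
      then show ?thesis using pi_bar.T_braid [of i "lascoux n \<gamma>"] by (simp add: L\<alpha> L\<beta> 2)
    next
      case 3
      define \<gamma> where "\<gamma> = \<beta> \<circ> ?s k"
      have lt: "\<beta> k < \<beta> (Suc k)" using i eq unfolding 3 \<beta>_def by (simp add: transpose_def)
      have \<gamma>: "\<gamma> \<in> compositions n" unfolding \<gamma>_def using \<beta> k by (rule compositions_swap)
      have w\<gamma>: "(\<Sum>k=1..n. k * \<gamma> k) < (\<Sum>k=1..n. k * \<alpha> k)"
        unfolding \<gamma>_def by (rule order.strict_trans [OF weighted_sum_swap [OF k lt] w\<beta>])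
      have L\<beta>: "lascoux n \<beta> = pi_bar k (lascoux n \<gamma>)"
        unfolding \<gamma>_def using \<beta> k lt by (rule lascoux_ascent)
      have "pi_bar i (lascoux n \<gamma>) = lascoux n \<gamma>"
        using eq i(1) by (intro less.hyps w\<gamma> \<gamma>) (auto simp: \<gamma>_def \<beta>_def transpose_def 3)
      then show ?thesis using pi_bar.T_braid [of k "lascoux n \<gamma>"] by (simp add: L\<alpha> L\<beta> 3)
    qed
  qed
qed

text \<open>Across an ascent or a level step \<open>pi_bar k\<close> fixes the Lascoux polynomial, and at a descent it
  is the defining step for the swapped composition.\<close>

lemma pi_bar_lascoux:
  assumes "\<alpha> \<in> compositions n" "k \<in> {1..<n}"
  obtains \<beta> where "\<beta> \<in> compositions n" "weight n \<beta> = weight n \<alpha>"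
    "pi_bar k (lascoux n \<alpha>) = lascoux n \<beta>"
proof -
  let ?\<beta> = "\<alpha> \<circ> transpose k (Suc k)"
  consider "\<alpha> k < \<alpha> (Suc k)" | "\<alpha> k = \<alpha> (Suc k)" | "\<alpha> (Suc k) < \<alpha> k" by linarith
  then show thesis
  proof cases
    case 1
    then have "pi_bar k (lascoux n \<alpha>) = lascoux n \<alpha>"
      using lascoux_ascent [OF assms] by (metis pi_bar_sym swap_pi_bar)
    then show ?thesis using assms(1) that by blast
  next
    case 2
    then show ?thesis using pi_bar_lascoux_level [OF assms] assms(1) that by blast
  next
    case 3
    have "?\<beta> \<circ> transpose k (Suc k) = \<alpha>" by (auto simp: o_def)
    moreover have "?\<beta> k < ?\<beta> (Suc k)" using 3 by simp
    ultimately have "lascoux n ?\<beta> = pi_bar k (lascoux n \<alpha>)"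
      using lascoux_ascent [OF compositions_swap [OF assms] assms(2)] by metis
    then show ?thesis
      using that [of ?\<beta>] compositions_swap [OF assms] weight_swap [OF assms(2)] by metis
  qed
qed


section \<open>Lowest-degree terms of Lascoux polynomials\<close>

definition deg :: "monomial \<Rightarrow> nat" where
  "deg p = (\<Sum>v\<in>Poly_Mapping.keys p. Poly_Mapping.lookup p v)"

text \<open>Moving two unequal exponents towards each other lowers the sum of squares. Since \<open>pi_bar i\<close>
  produces, in lowest degree, only exponent pairs between the given one and its reversal, the
  monomials of maximal spread can be followed through the operators.\<close>

definition spread :: "monomial \<Rightarrow> nat" where
  "spread p = (\<Sum>v\<in>Poly_Mapping.keys p. (Poly_Mapping.lookup p v)\<^sup>2)"

lemma deg_superset:
  "finite S \<Longrightarrow> Poly_Mapping.keys p \<subseteq> S \<Longrightarrow> deg p = (\<Sum>v\<in>S. Poly_Mapping.lookup p v)"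
  unfolding deg_def by (intro sum.mono_neutral_left) (auto simp: in_keys_iff)

lemma spread_superset:
  "finite S \<Longrightarrow> Poly_Mapping.keys p \<subseteq> S \<Longrightarrow> spread p = (\<Sum>v\<in>S. (Poly_Mapping.lookup p v)\<^sup>2)"
  unfolding spread_def by (intro sum.mono_neutral_left) (auto simp: in_keys_iff)

lemma deg_add: "deg (p + q) = deg p + deg q"
proof -
  define S where "S = Poly_Mapping.keys p \<union> Poly_Mapping.keys q"
  have S: "finite S" by (simp add: S_def)
  have "Poly_Mapping.keys (p + q) \<subseteq> S" unfolding S_def by (rule keys_add)
  then show ?thesis by (simp add: deg_superset [OF S] S_def lookup_add sum.distrib)
qed

lemma deg_single [simp]: "deg (Poly_Mapping.single v k) = k"
  by (simp add: deg_def)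

lemma spread_add_single:
  assumes "Poly_Mapping.lookup p v = 0"
  shows "spread (p + Poly_Mapping.single v k) = spread p + k\<^sup>2"
proof -
  define S where "S = insert v (Poly_Mapping.keys p)"
  have S: "finite S" by (simp add: S_def)
  have "Poly_Mapping.keys (p + Poly_Mapping.single v k) \<subseteq> S"
    using keys_add [of p "Poly_Mapping.single v k"] by (auto simp: S_def split: if_splits)
  then have "spread (p + Poly_Mapping.single v k) =
      (\<Sum>u\<in>S. (Poly_Mapping.lookup p u)\<^sup>2 + (if u = v then k\<^sup>2 else 0))"
    unfolding spread_superset [OF S \<open>_ \<subseteq> S\<close>] using assms
    by (intro sum.cong) (auto simp: lookup_add lookup_single when_def)
  also have "\<dots> = spread p + k\<^sup>2"
    by (simp add: sum.distrib S spread_superset [OF S] S_def subset_insertI)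
  finally show ?thesis .
qed

text \<open>A polynomial is judged by its terms of degree \<open>d\<close> and spread \<open>Q\<close>; everything of higher
  degree, or of degree \<open>d\<close> and smaller spread, is negligible and may have any sign. These sets are
  closed under addition and, as shown below, under every \<open>pi_bar i\<close>.\<close>

definition dominated :: "nat \<Rightarrow> nat \<Rightarrow> xypoly set" where
  "dominated d Q = {f. \<forall>p\<in>Poly_Mapping.keys f. d \<le> deg p \<and>
    (deg p = d \<longrightarrow> spread p \<le> Q \<and> (spread p = Q \<longrightarrow> 0 < Poly_Mapping.lookup f p))}"

lemma dominatedI:
  assumes "\<And>p. Poly_Mapping.lookup f p \<noteq> 0 \<Longrightarrow> d \<le> deg p"
    and "\<And>p. Poly_Mapping.lookup f p \<noteq> 0 \<Longrightarrow> deg p = d \<Longrightarrow> spread p \<le> Q"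
    and "\<And>p. deg p = d \<Longrightarrow> spread p = Q \<Longrightarrow> 0 \<le> Poly_Mapping.lookup f p"
  shows "f \<in> dominated d Q"
proof -
  have "d \<le> deg p \<and> (deg p = d \<longrightarrow> spread p \<le> Q \<and> (spread p = Q \<longrightarrow> 0 < Poly_Mapping.lookup f p))"
    if "Poly_Mapping.lookup f p \<noteq> 0" for p
    using assms(1,2) [OF that] assms(3) [of p] that by linarith
  then show ?thesis by (simp add: dominated_def in_keys_iff)
qed

lemma dominatedD:
  assumes "f \<in> dominated d Q"
  shows "Poly_Mapping.lookup f p \<noteq> 0 \<Longrightarrow> d \<le> deg p"
    and "Poly_Mapping.lookup f p \<noteq> 0 \<Longrightarrow> deg p = d \<Longrightarrow> spread p \<le> Q"
    and "deg p = d \<Longrightarrow> spread p = Q \<Longrightarrow> 0 \<le> Poly_Mapping.lookup f p"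
proof -
  have *: "Poly_Mapping.lookup f p \<noteq> 0 \<longrightarrow> d \<le> deg p \<and> (deg p = d \<longrightarrow> spread p \<le> Q \<and>
      (spread p = Q \<longrightarrow> 0 < Poly_Mapping.lookup f p))"
    using assms by (simp add: dominated_def in_keys_iff)
  show "Poly_Mapping.lookup f p \<noteq> 0 \<Longrightarrow> d \<le> deg p"
    "Poly_Mapping.lookup f p \<noteq> 0 \<Longrightarrow> deg p = d \<Longrightarrow> spread p \<le> Q"
    "deg p = d \<Longrightarrow> spread p = Q \<Longrightarrow> 0 \<le> Poly_Mapping.lookup f p"
    using * by linarith+
qed

lemma dominated_0 [simp]: "0 \<in> dominated d Q"
  by (rule dominatedI) simp_all

lemma dominated_add:
  assumes f: "f \<in> dominated d Q" and g: "g \<in> dominated d Q"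
  shows "f + g \<in> dominated d Q"
proof (rule dominatedI)
  fix p assume "Poly_Mapping.lookup (f + g) p \<noteq> 0"
  then have "Poly_Mapping.lookup f p \<noteq> 0 \<or> Poly_Mapping.lookup g p \<noteq> 0"
    unfolding lookup_add by linarith
  then show "d \<le> deg p" "deg p = d \<Longrightarrow> spread p \<le> Q"
    using dominatedD(1,2) [OF f] dominatedD(1,2) [OF g] by blast+
next
  fix p assume "deg p = d" "spread p = Q"
  then show "0 \<le> Poly_Mapping.lookup (f + g) p"
    unfolding lookup_add using dominatedD(3) [OF f] dominatedD(3) [OF g] by (intro add_nonneg_nonneg)
qed

lemma dominated_sum: "(\<And>x. x \<in> A \<Longrightarrow> f x \<in> dominated d Q) \<Longrightarrow> sum f A \<in> dominated d Q"
  by (induction A rule: infinite_finite_induct) (auto intro: dominated_add)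

lemma lookup_of_int_mult: "Poly_Mapping.lookup (of_int c * f) p = c * Poly_Mapping.lookup (f :: xypoly) p"
  by (induction c rule: int_induct [where k = 0]) (simp_all add: lookup_add lookup_minus distrib_right left_diff_distrib)

lemma dominated_scale:
  assumes f: "f \<in> dominated d Q" and c: "0 \<le> c"
  shows "of_int c * f \<in> dominated d Q"
  by (rule dominatedI) (use dominatedD [OF f] c in \<open>auto simp: lookup_of_int_mult\<close>)

lemma dominated_negligible:
  assumes f: "f \<in> dominated d' Q'" and less: "d < d' \<or> d = d' \<and> Q' < Q"
  shows "of_int c * f \<in> dominated d Q"
proof (rule dominatedI)
  fix p assume "Poly_Mapping.lookup (of_int c * f) p \<noteq> 0"
  then have "Poly_Mapping.lookup f p \<noteq> 0" by (simp add: lookup_of_int_mult)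
  note * = dominatedD(1,2) [OF f this]
  show "d \<le> deg p" "deg p = d \<Longrightarrow> spread p \<le> Q" using * less by linarith+
next
  fix p assume "deg p = d" "spread p = Q"
  then have "Poly_Mapping.lookup f p = 0" using dominatedD(1,2) [OF f, of p] less by linarith
  then show "0 \<le> Poly_Mapping.lookup (of_int c * f) p" by (simp add: lookup_of_int_mult)
qed

lemma dominated_weaken:
  assumes f: "f \<in> dominated d Q'" and le: "Q' \<le> Q"
  shows "f \<in> dominated d Q"
proof (cases "Q' = Q")
  case False
  then show ?thesis using dominated_negligible [OF f, of d Q 1] le by simp
qed (use f in simp)

lemma mono_of_dominated:
  "d \<le> deg p \<Longrightarrow> (deg p = d \<Longrightarrow> spread p \<le> Q) \<Longrightarrow> mono_of p \<in> dominated d Q"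
  by (rule dominatedI) (auto simp: lookup_single when_def split: if_splits)

lemma minus_mono_of_dominated:
  "d \<le> deg p \<Longrightarrow> (deg p = d \<Longrightarrow> spread p < Q) \<Longrightarrow> - mono_of p \<in> dominated d Q"
  by (rule dominatedI) (auto simp: lookup_single when_def split: if_splits)

text \<open>A monomial with its exponents at \<open>x\<^sub>i\<close> and \<open>x\<^sub>i\<^sub>+\<^sub>1\<close> made explicit.\<close>

definition two_row :: "nat \<Rightarrow> monomial \<Rightarrow> nat \<Rightarrow> nat \<Rightarrow> monomial" where
  "two_row i r a b = r + Poly_Mapping.single (X i) a + Poly_Mapping.single (X (Suc i)) b"

lemma var_power: "var v ^ k = mono_of (Poly_Mapping.single v k)"
  by (induction k) (simp_all add: var_def mult_single single_add [symmetric])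

lemma mono_of_two_row: "mono_of (two_row i r a b) = mono_of r * (xv i ^ a * xv (Suc i) ^ b)"
  by (simp add: var_power mult_single two_row_def add.assoc)

lemma deg_two_row: "deg (two_row i r a b) = deg r + a + b"
  by (simp add: two_row_def deg_add)

lemma spread_two_row:
  assumes "Poly_Mapping.lookup r (X i) = 0" "Poly_Mapping.lookup r (X (Suc i)) = 0"
  shows "spread (two_row i r a b) = spread r + a\<^sup>2 + b\<^sup>2"
  using assms by (simp add: two_row_def spread_add_single lookup_add lookup_single)

lemma two_row_decompose:
  obtains r where "p = two_row i r (Poly_Mapping.lookup p (X i)) (Poly_Mapping.lookup p (X (Suc i)))"
    "Poly_Mapping.lookup r (X i) = 0" "Poly_Mapping.lookup r (X (Suc i)) = 0"
proof -
  let ?r = "p - Poly_Mapping.single (X i) (Poly_Mapping.lookup p (X i))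
    - Poly_Mapping.single (X (Suc i)) (Poly_Mapping.lookup p (X (Suc i)))"
  show thesis
    by (rule that [of ?r])
      (auto simp: two_row_def lookup_add lookup_minus lookup_single when_def intro!: poly_mapping_eqI)
qed

lemma subst_mono_of: "subst \<sigma> (mono_of p) = monom_eval \<sigma> p"
  by (simp add: subst_single)

lemma swap_mono_of:
  assumes "Poly_Mapping.lookup r (X i) = 0" "Poly_Mapping.lookup r (X (Suc i)) = 0"
  shows "swap_vars i (mono_of r) = mono_of r"
proof -
  have "swap_vars i (mono_of r) = monom_eval var r"
    unfolding swap_vars_def subst_mono_of monom_eval_def using assms
    by (intro prod.cong refl) (auto simp: transpose_def in_keys_iff split: indet.split)
  also have "\<dots> = mono_of r"
    by (metis subst_mono_of subst_var_self)
  finally show ?thesis .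
qed

text \<open>The complete homogeneous symmetric polynomial of degree \<open>c - 1\<close> in \<open>x\<^sub>i, x\<^sub>i\<^sub>+\<^sub>1\<close>, and \<open>0\<close> for
  \<open>c = 0\<close>; shifting the index lets the formulas below hold for all \<open>c\<close>.\<close>

definition complete_two :: "nat \<Rightarrow> nat \<Rightarrow> xypoly" where
  "complete_two i c = (\<Sum>k<c. xv i ^ k * xv (Suc i) ^ (c - Suc k))"

lemma complete_two: "(xv i - xv (Suc i)) * complete_two i c = xv i ^ c - xv (Suc i) ^ c"
proof (cases c)
  case (Suc n)
  then show ?thesis
    using diff_power_eq_sum [of "xv i" n "xv (Suc i)"] by (simp add: complete_two_def)
qed (simp add: complete_two_def)

lemma pi_bar_eqI:
  "(xv i - xv (Suc i)) * g = (1 - xv (Suc i)) * (xv i * f) - (1 - xv i) * (xv (Suc i) * swap_vars i f)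
   \<Longrightarrow> pi_bar i f = g"
  unfolding pi_bar_def dd_bar_def by (rule dd_eqI) simp

lemma pi_bar_power_left:
  "pi_bar i (xv i ^ c) = complete_two i (Suc c) - xv i * xv (Suc i) * complete_two i c"
proof (rule pi_bar_eqI)
  let ?x = "xv i" and ?y = "xv (Suc i)"
  have "(?x - ?y) * (complete_two i (Suc c) - ?x * ?y * complete_two i c) =
    (?x - ?y) * complete_two i (Suc c) - ?x * ?y * ((?x - ?y) * complete_two i c)"
    by (simp only: right_diff_distrib mult.left_commute)
  then show "(?x - ?y) * (complete_two i (Suc c) - ?x * ?y * complete_two i c) =
    (1 - ?y) * (?x * ?x ^ c) - (1 - ?x) * (?y * swap_vars i (?x ^ c))"
    unfolding complete_two by (simp add: algebra_simps)
qed

lemma pi_bar_power_right: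
  "pi_bar i (xv (Suc i) ^ Suc c) = xv i * xv (Suc i) * (complete_two i (Suc c) - complete_two i c)"
proof (rule pi_bar_eqI)
  let ?x = "xv i" and ?y = "xv (Suc i)"
  have "(?x - ?y) * (?x * ?y * (complete_two i (Suc c) - complete_two i c)) =
    ?x * ?y * ((?x - ?y) * complete_two i (Suc c) - (?x - ?y) * complete_two i c)"
    by (simp only: right_diff_distrib mult.left_commute)
  then show "(?x - ?y) * (?x * ?y * (complete_two i (Suc c) - complete_two i c)) =
    (1 - ?y) * (?x * ?y ^ Suc c) - (1 - ?x) * (?y * swap_vars i (?y ^ Suc c))"
    unfolding complete_two by (simp add: algebra_simps)
qed

lemma complete_two_monomials:
  assumes "Poly_Mapping.lookup r (X i) = 0" "Poly_Mapping.lookup r (X (Suc i)) = 0"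
  shows "mono_of r * (xv i ^ a * xv (Suc i) ^ b * complete_two i c) =
    (\<Sum>k<c. mono_of (two_row i r (a + k) (b + (c - Suc k))))"
  unfolding complete_two_def sum_distrib_left mono_of_two_row power_add by (simp only: ac_simps)

text \<open>After the symmetric part \<open>(x\<^sub>i x\<^sub>i\<^sub>+\<^sub>1)\<^sup>m\<^sup>i\<^sup>n\<close> is taken out, \<open>p\<close> becomes a power of \<open>x\<^sub>i\<close> or of \<open>x\<^sub>i\<^sub>+\<^sub>1\<close>. In the
  first case the terms of lowest degree form a complete homogeneous polynomial, which contains \<open>p\<close>
  itself. In the second case negative terms of lowest degree appear, but their exponents lie strictly
  between the original ones, so their spread is smaller.\<close>

lemma pi_bar_monomial:
  shows "pi_bar i (mono_of p) \<in> dominated (deg p) (spread p)" (is ?thesis1)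
    and "Poly_Mapping.lookup p (X (Suc i)) \<le> Poly_Mapping.lookup p (X i) \<Longrightarrow>
      pi_bar i (mono_of p) - mono_of p \<in> dominated (deg p) (spread p)"
proof -
  let ?x = "xv i" and ?y = "xv (Suc i)"
  obtain r where r: "p = two_row i r (Poly_Mapping.lookup p (X i)) (Poly_Mapping.lookup p (X (Suc i)))"
    and r0: "Poly_Mapping.lookup r (X i) = 0" "Poly_Mapping.lookup r (X (Suc i)) = 0"
    by (rule two_row_decompose)
  define a b where "a = Poly_Mapping.lookup p (X i)" and "b = Poly_Mapping.lookup p (X (Suc i))"
  have p: "p = two_row i r a b" using r by (simp only: a_def b_def)
  have dp: "deg p = deg r + a + b" "spread p = spread r + a\<^sup>2 + b\<^sup>2"
    by (simp_all add: p deg_two_row spread_two_row r0)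
  have pb: "pi_bar i (mono_of r * (?x ^ e * ?y ^ e * f)) = mono_of r * (?x ^ e * ?y ^ e * pi_bar i f)" for e f
    using pi_bar_mult_sym [of i "mono_of r * (?x ^ e * ?y ^ e)" f] swap_mono_of [OF r0]
    by (simp add: ac_simps)
  have left: "pi_bar i (mono_of p) - mono_of p \<in> dominated (deg p) (spread p)" if ba: "b \<le> a"
  proof -
    obtain c where c: "a = b + c" using ba le_Suc_ex by blast
    have "mono_of p = mono_of r * (?x ^ b * ?y ^ b * ?x ^ c)"
      by (simp add: p c mono_of_two_row power_add ac_simps)
    then have "pi_bar i (mono_of p) = mono_of r * (?x ^ b * ?y ^ b * complete_two i (Suc c))
        - mono_of r * (?x ^ Suc b * ?y ^ Suc b * complete_two i c)"
      by (simp only: pb pi_bar_power_left) (simp add: algebra_simps)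
    also have "\<dots> = (\<Sum>k<Suc c. mono_of (two_row i r (b + k) (b + (Suc c - Suc k))))
        - (\<Sum>k<c. mono_of (two_row i r (Suc b + k) (Suc b + (c - Suc k))))"
      by (simp only: complete_two_monomials [OF r0])
    also have "\<dots> = mono_of p + (\<Sum>k<c. mono_of (two_row i r (b + k) (b + (c - k))))
        + (\<Sum>k<c. - mono_of (two_row i r (Suc b + k) (Suc b + (c - Suc k))))"
      by (simp add: p c sum_negf)
    finally have eq: "pi_bar i (mono_of p) - mono_of p =
        (\<Sum>k<c. mono_of (two_row i r (b + k) (b + (c - k))))
        + (\<Sum>k<c. - mono_of (two_row i r (Suc b + k) (Suc b + (c - Suc k))))"
      by simp
    show ?thesis
      unfolding eq
    proof (intro dominated_add dominated_sum)
      fix k assume "k \<in> {..<c}"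
      then obtain l where l: "c = k + l" using le_Suc_ex by fastforce
      have "(b + k)\<^sup>2 + (b + l)\<^sup>2 \<le> (b + (k + l))\<^sup>2 + b\<^sup>2"
        by (simp add: power2_eq_square algebra_simps)
      then show "mono_of (two_row i r (b + k) (b + (c - k))) \<in> dominated (deg p) (spread p)"
        by (intro mono_of_dominated) (simp_all add: deg_two_row spread_two_row r0 dp l c)
    next
      fix k assume "k \<in> {..<c}"
      then have "deg p < deg (two_row i r (Suc b + k) (Suc b + (c - Suc k)))"
        by (simp add: deg_two_row dp c)
      then show "- mono_of (two_row i r (Suc b + k) (Suc b + (c - Suc k))) \<in> dominated (deg p) (spread p)"
        by (intro minus_mono_of_dominated) simp_all
    qed
  qed
  then show "Poly_Mapping.lookup p (X (Suc i)) \<le> Poly_Mapping.lookup p (X i) \<Longrightarrow>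
      pi_bar i (mono_of p) - mono_of p \<in> dominated (deg p) (spread p)"
    by (simp add: a_def b_def)
  show ?thesis1
  proof (cases "b \<le> a")
    case True
    have "mono_of p \<in> dominated (deg p) (spread p)" by (rule mono_of_dominated) simp_all
    then show ?thesis using dominated_add [OF left [OF True]] by force
  next
    case False
    then obtain c where c: "b = a + Suc c" by (metis add_Suc_right less_imp_Suc_add not_le)
    have "mono_of p = mono_of r * (?x ^ a * ?y ^ a * ?y ^ Suc c)"
      by (simp add: p c mono_of_two_row power_add ac_simps)
    then have "pi_bar i (mono_of p) = mono_of r * (?x ^ Suc a * ?y ^ Suc a * complete_two i (Suc c))
        - mono_of r * (?x ^ Suc a * ?y ^ Suc a * complete_two i c)"
      by (simp only: pb pi_bar_power_right) (simp add: algebra_simps)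
    also have "\<dots> = (\<Sum>k<Suc c. mono_of (two_row i r (Suc a + k) (Suc a + (Suc c - Suc k))))
        + (\<Sum>k<c. - mono_of (two_row i r (Suc a + k) (Suc a + (c - Suc k))))"
      by (simp only: complete_two_monomials [OF r0] sum_negf diff_conv_add_uminus)
    finally have eq: "pi_bar i (mono_of p) = \<dots>" .
    show ?thesis
      unfolding eq
    proof (intro dominated_add dominated_sum)
      fix k assume "k \<in> {..<Suc c}"
      then have "deg p < deg (two_row i r (Suc a + k) (Suc a + (Suc c - Suc k)))"
        by (simp add: deg_two_row dp c)
      then show "mono_of (two_row i r (Suc a + k) (Suc a + (Suc c - Suc k))) \<in> dominated (deg p) (spread p)"
        by (intro mono_of_dominated) simp_all
    next
      fix k assume "k \<in> {..<c}"
      then obtain l where l: "c = Suc k + l" using le_Suc_ex [of "Suc k" c] by auto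
      have "(Suc a + k)\<^sup>2 + (Suc a + l)\<^sup>2 < a\<^sup>2 + (a + Suc (Suc k + l))\<^sup>2"
        by (simp add: power2_eq_square algebra_simps)
      then show "- mono_of (two_row i r (Suc a + k) (Suc a + (c - Suc k))) \<in> dominated (deg p) (spread p)"
        by (intro minus_mono_of_dominated) (simp_all add: deg_two_row spread_two_row r0 dp l c)
    qed
  qed
qed

lemma single_eq_of_int_mult: "Poly_Mapping.single p c = of_int c * mono_of p"
  by (rule poly_mapping_eqI) (simp add: lookup_of_int_mult lookup_single when_def)

lemma monomial_expansion:
  "f = (\<Sum>p\<in>Poly_Mapping.keys f. of_int (Poly_Mapping.lookup f p) * mono_of p)"
  by (simp only: single_eq_of_int_mult [symmetric] sum_monomials)

lemma dominated_pi_bar: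
  assumes "f \<in> dominated d Q"
  shows "pi_bar i f \<in> dominated d Q"
proof -
  have "pi_bar i f = (\<Sum>p\<in>Poly_Mapping.keys f. of_int (Poly_Mapping.lookup f p) * pi_bar i (mono_of p))"
    by (subst (1) monomial_expansion) (simp only: pi_bar_sum pi_bar_of_int)
  moreover have "of_int (Poly_Mapping.lookup f p) * pi_bar i (mono_of p) \<in> dominated d Q"
    if p: "p \<in> Poly_Mapping.keys f" for p
  proof (cases "deg p = d \<and> spread p = Q")
    case True
    then show ?thesis using dominatedD(3) [OF assms, of p] pi_bar_monomial(1) [of i p]
      by (intro dominated_scale) auto
  next
    case False
    then have "d < deg p \<or> d = deg p \<and> spread p < Q"
      using dominatedD(1,2) [OF assms, of p] p by (auto simp: in_keys_iff)
    then show ?thesis by (rule dominated_negligible [OF pi_bar_monomial(1)])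
  qed
  ultimately show ?thesis by (simp add: dominated_sum)
qed

text \<open>A monomial with \<open>p(x\<^sub>i) \<ge> p(x\<^sub>i\<^sub>+\<^sub>1)\<close> reproduces itself, and by \<open>pi_bar_monomial\<close> no other term of
  \<open>f\<close> can contribute a negative amount to its coefficient.\<close>

lemma pi_bar_keeps_leading:
  assumes f: "f \<in> dominated (deg p) (spread p)" and p: "p \<in> Poly_Mapping.keys f"
    and dom: "Poly_Mapping.lookup p (X (Suc i)) \<le> Poly_Mapping.lookup p (X i)"
  shows "p \<in> Poly_Mapping.keys (pi_bar i f)"
proof -
  define c where "c = Poly_Mapping.lookup f p"
  have c: "0 < c" using dominatedD(3) [OF f, of p] p by (simp add: in_keys_iff c_def)
  define f' where "f' = f - of_int c * mono_of p"
  have l: "Poly_Mapping.lookup f' q = (if q = p then 0 else Poly_Mapping.lookup f q)" for q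
    by (auto simp: f'_def lookup_minus lookup_of_int_mult lookup_single when_def c_def)
  have f': "f' \<in> dominated (deg p) (spread p)"
    by (rule dominatedI) (use dominatedD [OF f] in \<open>auto simp: l split: if_splits\<close>)
  define g where "g = of_int c * (pi_bar i (mono_of p) - mono_of p) + pi_bar i f'"
  have "g \<in> dominated (deg p) (spread p)"
    unfolding g_def using c pi_bar_monomial(2) [OF dom] f'
    by (intro dominated_add dominated_scale dominated_pi_bar) simp_all
  then have "0 \<le> Poly_Mapping.lookup g p"
    by (rule dominatedD(3)) simp_all
  moreover have "pi_bar i f = of_int c * mono_of p + g"
  proof -
    have "f = of_int c * mono_of p + f'" by (simp add: f'_def)
    then have "pi_bar i f = of_int c * pi_bar i (mono_of p) + pi_bar i f'"
      by (metis pi_bar_add pi_bar_of_int)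
    then show ?thesis by (simp add: g_def algebra_simps)
  qed
  ultimately show ?thesis
    using c by (simp add: in_keys_iff lookup_add lookup_of_int_mult)
qed

text \<open>The existence of \<open>p\<close> makes \<open>d\<close> the exact lowest degree, and positivity at maximal spread makes
  this stable under addition.\<close>

definition leading :: "nat \<Rightarrow> xypoly \<Rightarrow> bool" where
  "leading d f \<longleftrightarrow> (\<exists>p\<in>Poly_Mapping.keys f. deg p = d \<and> f \<in> dominated d (spread p))"

definition comp_monomial :: "nat \<Rightarrow> (nat \<Rightarrow> nat) \<Rightarrow> monomial" where
  "comp_monomial n \<alpha> = (\<Sum>i=1..n. Poly_Mapping.single (X i) (\<alpha> i))"

lemma mono_of_comp_monomial: "(\<Prod>i=1..n. xv i ^ \<alpha> i) = mono_of (comp_monomial n \<alpha>)"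
proof -
  have "(\<Prod>i\<in>A. mono_of (Poly_Mapping.single (X i) (\<alpha> i))) =
      mono_of (\<Sum>i\<in>A. Poly_Mapping.single (X i) (\<alpha> i))" for A
    by (induction A rule: infinite_finite_induct) (simp_all add: mult_single)
  then show ?thesis by (simp add: var_power comp_monomial_def)
qed

lemma lookup_comp_monomial:
  "Poly_Mapping.lookup (comp_monomial n \<alpha>) (X i) = (if i \<in> {1..n} then \<alpha> i else 0)"
  by (simp add: comp_monomial_def lookup_sum lookup_single when_def)

lemma deg_comp_monomial: "deg (comp_monomial n \<alpha>) = weight n \<alpha>"
proof -
  have "deg (\<Sum>i\<in>A. Poly_Mapping.single (X i) (\<alpha> i)) = sum \<alpha> A" for A
    by (induction A rule: infinite_finite_induct) (simp_all add: deg_add, simp_all add: deg_def)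
  then show ?thesis by (simp add: comp_monomial_def weight_def)
qed

text \<open>The witness is the monomial whose exponents are those of \<open>\<alpha>\<close> in weakly decreasing order: it is the
  whole polynomial at the start of the recursion and survives every \<open>pi_bar i\<close>.\<close>

lemma leading_lascoux:
  assumes "\<alpha> \<in> compositions n"
  shows "leading (weight n \<alpha>) (lascoux n \<alpha>)"
proof -
  have "\<exists>p\<in>Poly_Mapping.keys (lascoux n \<alpha>). deg p = weight n \<alpha> \<and>
      lascoux n \<alpha> \<in> dominated (weight n \<alpha>) (spread p) \<and>
      (\<forall>i\<in>{1..<n}. Poly_Mapping.lookup p (X (Suc i)) \<le> Poly_Mapping.lookup p (X i))"
    using assms
  proof (induction rule: composition_induct)
    case (dominant \<alpha>)
    have L: "lascoux n \<alpha> = mono_of (comp_monomial n \<alpha>)"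
      unfolding mono_of_comp_monomial [symmetric] by (rule lascoux_dominant) (use dominant in auto)
    show ?case
      by (rule bexI [of _ "comp_monomial n \<alpha>"])
        (use dominant(2) in \<open>auto simp: L deg_comp_monomial lookup_comp_monomial intro: mono_of_dominated\<close>)
  next
    case (ascent \<alpha> i)
    let ?\<beta> = "\<alpha> \<circ> transpose i (Suc i)"
    have L: "lascoux n \<alpha> = pi_bar i (lascoux n ?\<beta>)" by (rule lascoux_ascent) fact+
    have w: "weight n ?\<beta> = weight n \<alpha>" using ascent(2) by (rule weight_swap)
    from ascent.IH obtain p where p: "p \<in> Poly_Mapping.keys (lascoux n ?\<beta>)" "deg p = weight n \<alpha>"
      "lascoux n ?\<beta> \<in> dominated (weight n \<alpha>) (spread p)"
      "\<forall>i\<in>{1..<n}. Poly_Mapping.lookup p (X (Suc i)) \<le> Poly_Mapping.lookup p (X i)"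
      unfolding w by blast
    then show ?case
      unfolding L using ascent(2) pi_bar_keeps_leading [of "lascoux n ?\<beta>" p i]
      by (intro bexI [of _ p]) (auto intro: dominated_pi_bar)
  qed
  then show ?thesis unfolding leading_def by blast
qed

lemma lowest_degree_eq:
  assumes "p \<in> Poly_Mapping.keys f" "deg p = d" "\<And>q. q \<in> Poly_Mapping.keys f \<Longrightarrow> d \<le> deg q"
  shows "lowest_degree f = d"
  unfolding lowest_degree_def deg_def [symmetric] using assms
  by (intro Min_eqI) auto

lemma leading_lowest_degree:
  assumes "leading d f"
  shows "f \<noteq> 0" "lowest_degree f = d"
proof -
  obtain p where p: "p \<in> Poly_Mapping.keys f" "deg p = d" "f \<in> dominated d (spread p)"
    using assms unfolding leading_def by blast
  show "f \<noteq> 0" using p(1) by auto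
  show "lowest_degree f = d"
    using p(1,2) dominatedD(1) [OF p(3)] by (intro lowest_degree_eq) (auto simp: in_keys_iff)
qed

text \<open>Of the two leading monomials, the one with larger spread remains.\<close>

lemma leading_add:
  assumes "leading d f" "leading d g"
  shows "leading d (f + g)"
proof -
  have *: "leading d (f + g)" if p: "p \<in> Poly_Mapping.keys f" "deg p = d" "f \<in> dominated d (spread p)"
    and q: "g \<in> dominated d (spread q)" and le: "spread q \<le> spread p" for f g p q
  proof -
    have g: "g \<in> dominated d (spread p)" using q le by (rule dominated_weaken)
    have "0 \<le> Poly_Mapping.lookup g p"
      using g p(2) by (rule dominatedD(3)) simp
    moreover have "0 < Poly_Mapping.lookup f p"
      using dominatedD(3) [OF p(3,2)] p(1) by (simp add: in_keys_iff)
    ultimately have "p \<in> Poly_Mapping.keys (f + g)" by (simp add: in_keys_iff lookup_add)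
    then show ?thesis using dominated_add [OF p(3) g] p(2) unfolding leading_def by blast
  qed
  obtain p q where "p \<in> Poly_Mapping.keys f" "deg p = d" "f \<in> dominated d (spread p)"
    "q \<in> Poly_Mapping.keys g" "deg q = d" "g \<in> dominated d (spread q)"
    using assms unfolding leading_def by blast
  then show ?thesis
    using *[of p f g q] *[of q g f p] by (cases "spread q \<le> spread p") (simp_all add: add.commute)
qed

lemma leading_add_higher:
  assumes f: "leading d f" and g: "leading e g" and de: "d < e"
  shows "leading d (f + of_int c * g)"
proof -
  obtain p where p: "p \<in> Poly_Mapping.keys f" "deg p = d" "f \<in> dominated d (spread p)"
    using f unfolding leading_def by blast
  obtain Q where "g \<in> dominated e Q" using g unfolding leading_def by blast
  then have g': "of_int c * g \<in> dominated d (spread p)" using de by (intro dominated_negligible) auto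
  have "Poly_Mapping.lookup g p = 0"
    using dominatedD(1) [OF \<open>g \<in> dominated e Q\<close>, of p] p(2) de by linarith
  then have "p \<in> Poly_Mapping.keys (f + of_int c * g)"
    using p(1) by (simp add: in_keys_iff lookup_add lookup_of_int_mult)
  then show ?thesis using dominated_add [OF p(3) g'] p(2) unfolding leading_def by blast
qed


section \<open>Graded nonnegativity\<close>

text \<open>The polynomials that are graded nonnegative with lowest degree \<open>d\<close>. Building them by adding
  signed terms of higher or equal degree makes it immediate that a linear operator has to be checked
  on Lascoux polynomials only, without handling index sets and coefficients.\<close>

inductive lascoux_positive :: "nat \<Rightarrow> nat \<Rightarrow> xypoly \<Rightarrow> bool" for n where
  basis: "lascoux_positive n (weight n \<alpha>) (lascoux n \<alpha>)" if "\<alpha> \<in> compositions n"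
| add: "lascoux_positive n d (f + (-1) ^ (d + e) * g)"
    if "lascoux_positive n d f" "lascoux_positive n e g" "d \<le> e"

lemma lascoux_positive_leading: "lascoux_positive n d f \<Longrightarrow> leading d f"
proof (induction rule: lascoux_positive.induct)
  case (basis \<alpha>)
  then show ?case by (rule leading_lascoux)
next
  case (add d f e g)
  have eq: "(-1) ^ (d + e) = (of_int ((-1) ^ (d + e)) :: xypoly)" by simp
  show ?case
  proof (cases "d = e")
    case True
    then show ?thesis using leading_add [OF add.IH(1)] add.IH(2) by (simp add: mult_2 [symmetric])
  next
    case False
    then show ?thesis unfolding eq using add by (intro leading_add_higher) auto
  qed
qed

lemma lascoux_positive_graded_nonneg:
  assumes "lascoux_positive n d f"
  shows "graded_nonneg n f"
proof -
  have "\<exists>A c. finite A \<and> A \<subseteq> compositions n \<and> (\<forall>\<alpha>. 0 \<le> c \<alpha>) \<and> (\<forall>\<alpha>. \<alpha> \<notin> A \<longrightarrow> c \<alpha> = (0::int)) \<and>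
      f = (\<Sum>\<alpha>\<in>A. (-1) ^ (weight n \<alpha> + d) * of_int (c \<alpha>) * lascoux n \<alpha>)"
    using assms
  proof induction
    case (basis \<alpha>)
    show ?case
      using basis by (intro exI [of _ "{\<alpha>}"] exI [of _ "\<lambda>\<beta>. if \<beta> = \<alpha> then 1 else 0"])
        (auto simp: mult_2 [symmetric])
  next
    case (add d f e g)
    then obtain A a B b where A: "finite A" "A \<subseteq> compositions n" "\<forall>\<alpha>. 0 \<le> a \<alpha>" "\<forall>\<alpha>. \<alpha> \<notin> A \<longrightarrow> a \<alpha> = (0::int)"
        and f: "f = (\<Sum>\<alpha>\<in>A. (-1) ^ (weight n \<alpha> + d) * of_int (a \<alpha>) * lascoux n \<alpha>)"
        and B: "finite B" "B \<subseteq> compositions n" "\<forall>\<alpha>. 0 \<le> b \<alpha>" "\<forall>\<alpha>. \<alpha> \<notin> B \<longrightarrow> b \<alpha> = (0::int)"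
        and g: "g = (\<Sum>\<alpha>\<in>B. (-1) ^ (weight n \<alpha> + e) * of_int (b \<alpha>) * lascoux n \<alpha>)"
      by blast
    have f': "f = (\<Sum>\<alpha>\<in>A \<union> B. (-1) ^ (weight n \<alpha> + d) * of_int (a \<alpha>) * lascoux n \<alpha>)"
      unfolding f using A B by (intro sum.mono_neutral_left) auto
    have g': "g = (\<Sum>\<alpha>\<in>A \<union> B. (-1) ^ (weight n \<alpha> + e) * of_int (b \<alpha>) * lascoux n \<alpha>)"
      unfolding g using A B by (intro sum.mono_neutral_left) auto
    have sign: "(-1) ^ (d + e) * ((-1) ^ (w + e) * x) = (-1) ^ (w + d) * (x :: xypoly)" for w x
      by (cases "even d"; cases "even e"; cases "even w") simp_all
    have "f + (-1) ^ (d + e) * g =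
        (\<Sum>\<alpha>\<in>A \<union> B. (-1) ^ (weight n \<alpha> + d) * of_int (a \<alpha> + b \<alpha>) * lascoux n \<alpha>)"
      unfolding f' g' sum_distrib_left mult.assoc sign
      by (simp add: sum.distrib [symmetric] algebra_simps)
    then show ?case
      using A B by (intro exI [of _ "A \<union> B"] exI [of _ "\<lambda>\<alpha>. a \<alpha> + b \<alpha>"]) auto
  qed
  then show ?thesis
    using leading_lowest_degree [OF lascoux_positive_leading [OF assms]]
    unfolding graded_nonneg_def by auto
qed

lemma lascoux_positive_scale:
  assumes "lascoux_positive n d f" "0 < c"
  shows "lascoux_positive n d (of_int c * f)"
proof -
  have "lascoux_positive n d (of_nat (Suc k) * f)" for k
  proof (induction k)
    case (Suc k)
    then show ?case
      using lascoux_positive.add [OF Suc assms(1) order.refl] by (simp add: mult_2 [symmetric] algebra_simps)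
  qed (use assms in simp)
  moreover obtain k where "c = int (Suc k)" using assms(2) by (metis gr0_implies_Suc zero_less_imp_eq_int)
  ultimately show ?thesis by simp
qed

text \<open>A signed combination with nonnegative coefficients is, up to a sign, \<open>lascoux_positive n d\<close> with
  \<open>d\<close> the least \<open>|\<alpha>|\<close> that occurs. By \<open>lascoux_positive_leading\<close> this \<open>d\<close> is the lowest
  degree, whence the sign is the right one.\<close>

lemma graded_nonneg_lascoux_positive:
  assumes "graded_nonneg n f"
  shows "lascoux_positive n (lowest_degree f) f"
proof -
  define \<epsilon> where "\<epsilon> = lowest_degree f"
  define P where "P = (\<lambda>F. \<exists>d. lascoux_positive n d ((-1) ^ (d + \<epsilon>) * F))"
  have sign: "(-1) ^ (d + e) * ((-1) ^ (e + w) * x) = (-1) ^ (d + w) * (x :: xypoly)" for d e w x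
    by (cases "even d"; cases "even e"; cases "even w") simp_all
  have P_add': "P (F + G)" if "lascoux_positive n d ((-1) ^ (d + \<epsilon>) * F)"
    "lascoux_positive n e ((-1) ^ (e + \<epsilon>) * G)" "d \<le> e" for d e F G
    using lascoux_positive.add [OF that] unfolding P_def sign by (auto simp: distrib_left)
  have P_add: "P (F + G)" if PF: "P F" and PG: "P G" for F G
  proof -
    obtain d e where "lascoux_positive n d ((-1) ^ (d + \<epsilon>) * F)"
      "lascoux_positive n e ((-1) ^ (e + \<epsilon>) * G)" using PF PG unfolding P_def by blast
    then show ?thesis using P_add' [of d F e G] P_add' [of e G d F]
      by (cases "d \<le> e") (simp_all add: add.commute)
  qed
  have P_sum: "(\<Sum>\<alpha>\<in>A. (-1) ^ (weight n \<alpha> + \<epsilon>) * of_int (c \<alpha>) * lascoux n \<alpha>) = 0 \<or>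
      P (\<Sum>\<alpha>\<in>A. (-1) ^ (weight n \<alpha> + \<epsilon>) * of_int (c \<alpha>) * lascoux n \<alpha>)"
    if "finite A" "A \<subseteq> compositions n" "\<forall>\<alpha>\<in>A. 0 \<le> (c \<alpha> :: int)" for A c
    using that
  proof (induction A rule: finite_induct)
    case (insert \<alpha> A)
    let ?t = "(-1) ^ (weight n \<alpha> + \<epsilon>) * of_int (c \<alpha>) * lascoux n \<alpha>"
    have "?t = 0 \<or> P ?t"
    proof (cases "c \<alpha> = 0")
      case False
      then have "lascoux_positive n (weight n \<alpha>) (of_int (c \<alpha>) * lascoux n \<alpha>)"
        using insert.prems by (intro lascoux_positive_scale lascoux_positive.basis) auto
      then have "P ?t"
        unfolding P_def by (intro exI [of _ "weight n \<alpha>"]) (simp add: mult.assoc [symmetric] power_add [symmetric] mult_2 [symmetric])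
      then show ?thesis ..
    qed simp
    then show ?case using insert P_add by auto
  qed simp
  obtain A c where "finite A" "A \<subseteq> compositions n" "\<forall>\<alpha>\<in>A. 0 \<le> (c \<alpha> :: int)" and
    f: "f = (\<Sum>\<alpha>\<in>A. (-1) ^ (weight n \<alpha> + \<epsilon>) * of_int (c \<alpha>) * lascoux n \<alpha>)" and "f \<noteq> 0"
    using assms unfolding graded_nonneg_def \<epsilon>_def by blast
  then have "P f" using P_sum [of A c] by simp
  then obtain d where d: "lascoux_positive n d ((-1) ^ (d + \<epsilon>) * f)" unfolding P_def by blast
  have "lowest_degree ((-1) ^ (d + \<epsilon>) * f) = lowest_degree f"
    by (cases "even (d + \<epsilon>)") (simp_all add: lowest_degree_def)
  then have "d = \<epsilon>"
    using leading_lowest_degree(2) [OF lascoux_positive_leading [OF d]] by (simp add: \<epsilon>_def)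
  then show ?thesis using d by (simp add: \<epsilon>_def mult_2 [symmetric])
qed

lemma lascoux_positive_map:
  assumes "lascoux_positive n d f"
    and "\<And>f g k. T (f + (-1) ^ k * g) = T f + (-1) ^ k * T g"
    and "\<And>\<alpha>. \<alpha> \<in> compositions n \<Longrightarrow> lascoux_positive n (weight n \<alpha> + i) (T (lascoux n \<alpha>))"
  shows "lascoux_positive n (d + i) (T f)"
  using assms(1)
proof induction
  case (basis \<alpha>)
  then show ?case by (rule assms(3))
next
  case (add d f e g)
  have "(-1 :: xypoly) ^ (d + e) = (-1) ^ ((d + i) + (e + i))"
    by (cases "even d"; cases "even e"; cases "even i") simp_all
  then show ?case
    using lascoux_positive.add [OF add.IH] add.hyps by (simp add: assms(2))
qed

lemma lascoux_positive_pi_bar: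
  assumes "lascoux_positive n d f" "k \<in> {1..<n}"
  shows "lascoux_positive n d (pi_bar k f)"
proof -
  have "lascoux_positive n (d + 0) (pi_bar k f)"
  proof (rule lascoux_positive_map [OF assms(1)])
    show "pi_bar k (f + (-1) ^ j * g) = pi_bar k f + (-1) ^ j * pi_bar k g" for f g j
      by (simp add: pi_bar_add pi_bar_mult_sym)
    show "lascoux_positive n (weight n \<alpha> + 0) (pi_bar k (lascoux n \<alpha>))"
      if "\<alpha> \<in> compositions n" for \<alpha>
      using pi_bar_lascoux [OF that assms(2)] lascoux_positive.basis by (metis add_0_right)
  qed
  then show ?thesis by simp
qed


section \<open>Multiplication by a column\<close>

text \<open>Unlike the degree, the spread is not additive under multiplication of monomials; through
  products only the lowest degree is followed.\<close>

definition starts_at :: "nat \<Rightarrow> xypoly \<Rightarrow> bool" where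
  "starts_at d f \<longleftrightarrow> (\<exists>p\<in>Poly_Mapping.keys f. deg p = d) \<and> (\<forall>p\<in>Poly_Mapping.keys f. d \<le> deg p)"

lemma starts_at_lowest_degree: "starts_at d f \<Longrightarrow> lowest_degree f = d"
  unfolding starts_at_def by (metis lowest_degree_eq)

lemma leading_starts_at: "leading d f \<Longrightarrow> starts_at d f"
  unfolding leading_def starts_at_def using dominatedD(1) by (metis in_keys_iff)

lemma keys_mono_of_mult:
  "Poly_Mapping.keys (mono_of s * f) = (\<lambda>p. s + p) ` Poly_Mapping.keys (f :: xypoly)"
proof -
  have e: "mono_of s * f = (\<Sum>p\<in>Poly_Mapping.keys f. Poly_Mapping.single (s + p) (Poly_Mapping.lookup f p))"
    by (subst (1) sum_monomials [of f, symmetric]) (simp only: sum_distrib_left mult_single mult_1)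
  have "Poly_Mapping.lookup (mono_of s * f) q =
      (\<Sum>p\<in>Poly_Mapping.keys f. Poly_Mapping.lookup f p when s + p = q)" for q
    unfolding e by (simp add: lookup_sum lookup_single)
  then have 1: "Poly_Mapping.lookup (mono_of s * f) (s + r) = Poly_Mapping.lookup f r"
    and 2: "q \<notin> (\<lambda>p. s + p) ` Poly_Mapping.keys f \<Longrightarrow> Poly_Mapping.lookup (mono_of s * f) q = 0"
    for q r
    by (auto simp: when_def in_keys_iff intro!: sum.neutral)
  show ?thesis
    using 1 2 by (auto simp: in_keys_iff image_iff)
qed

lemma starts_at_var_mult:
  assumes "starts_at d f"
  shows "starts_at (Suc d) (var v * f)"
  using assms unfolding starts_at_def var_def by (auto simp: keys_mono_of_mult deg_add)

lemma starts_at_one_minus_var_mult: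
  assumes "starts_at d f"
  shows "starts_at d ((1 - var v) * f)"
proof -
  obtain p where p: "p \<in> Poly_Mapping.keys f" "deg p = d" using assms unfolding starts_at_def by blast
  have f: "q \<in> Poly_Mapping.keys f \<Longrightarrow> d \<le> deg q" for q using assms unfolding starts_at_def by blast
  have vf: "q \<in> Poly_Mapping.keys (var v * f) \<Longrightarrow> Suc d \<le> deg q" for q
    using starts_at_var_mult [OF assms] unfolding starts_at_def by blast
  have eq: "(1 - var v) * f = f - var v * f" by (simp add: algebra_simps)
  have "p \<notin> Poly_Mapping.keys (var v * f)" using vf [of p] p(2) by auto
  then have "p \<in> Poly_Mapping.keys ((1 - var v) * f)"
    using p(1) unfolding eq by (simp add: in_keys_iff lookup_minus)
  moreover have "d \<le> deg q" if "q \<in> Poly_Mapping.keys ((1 - var v) * f)" for q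
    using that keys_diff [of f "var v * f"] f [of q] vf [of q] unfolding eq by auto
  ultimately show ?thesis using p(2) unfolding starts_at_def by blast
qed

definition column_factor :: "nat \<Rightarrow> nat \<Rightarrow> xypoly" where
  "column_factor n i = (\<Prod>k=1..i. xv k) * (\<Prod>k=i+1..n. 1 - xv k)"

lemma starts_at_column_factor:
  assumes "starts_at d f"
  shows "starts_at (d + i) (column_factor n i * f)"
proof -
  have "starts_at d ((\<Prod>k\<in>A. 1 - xv k) * f)" for A
    using assms
    by (induction A rule: infinite_finite_induct) (simp_all add: mult.assoc starts_at_one_minus_var_mult)
  moreover have "starts_at (e + i) ((\<Prod>k=1..i. xv k) * g)" if "starts_at e g" for e g
    using that by (induction i) (simp_all add: mult.assoc mult.left_commute starts_at_var_mult)
  ultimately show ?thesis by (simp add: column_factor_def mult.assoc)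
qed

text \<open>The lowest degree of the product is \<open>|\<alpha>| + i\<close>, so the signs of its expansion agree with those
  needed when the expansions for different \<open>\<alpha>\<close> are added.\<close>

lemma lascoux_positive_column_factor:
  assumes "\<And>\<alpha>. \<alpha> \<in> compositions n \<Longrightarrow> graded_nonneg n (column_factor n i * lascoux n \<alpha>)"
    and "lascoux_positive n d f"
  shows "lascoux_positive n (d + i) (column_factor n i * f)"
proof (rule lascoux_positive_map [OF assms(2)])
  show "column_factor n i * (f + (-1) ^ k * g) = column_factor n i * f + (-1) ^ k * (column_factor n i * g)"
    for f g k by (simp add: algebra_simps)
  fix \<alpha> assume \<alpha>: "\<alpha> \<in> compositions n"
  have "lowest_degree (column_factor n i * lascoux n \<alpha>) = weight n \<alpha> + i"
    by (intro starts_at_lowest_degree starts_at_column_factor leading_starts_at leading_lascoux \<alpha>)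
  then show "lascoux_positive n (weight n \<alpha> + i) (column_factor n i * lascoux n \<alpha>)"
    using graded_nonneg_lascoux_positive [OF assms(1) [OF \<alpha>]] by simp
qed

lemma pi_bar_one_minus: "pi_bar k (1 - xv k) = (1 - xv k) * (1 - xv (Suc k))"
  by (rule pi_bar_eqI) (simp add: algebra_simps)

lemma swap_prod_permuted:
  assumes "bij_betw (transpose k (Suc k)) A A" "\<And>i. i \<in> A \<Longrightarrow> swap_vars k (F i) = F (transpose k (Suc k) i)"
  shows "swap_vars k (\<Prod>i\<in>A. F i) = (\<Prod>i\<in>A. F i)"
  using prod.reindex_bij_betw [OF assms(1), of F] assms(2) by simp

text \<open>Multiply by \<open>1 - x\<^sub>k\<^sub>+\<^sub>1\<close> one index at a time. If the exponent drops before \<open>k + 1\<close>, then raising it by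
  one keeps the sequence weakly decreasing, and the product is a difference of two known cases. If
  \<open>\<nu> k = \<nu> (Suc k)\<close>, then \<open>pi_bar k\<close> turns \<open>1 - x\<^sub>k\<close> into \<open>(1 - x\<^sub>k)(1 - x\<^sub>k\<^sub>+\<^sub>1)\<close> and leaves the other
  factors alone.\<close>

lemma lascoux_positive_partial_product:
  assumes "\<nu> \<in> compositions n" "\<And>i. i \<in> {1..<n} \<Longrightarrow> \<nu> (Suc i) \<le> \<nu> i" "k \<le> n"
  shows "lascoux_positive n (weight n \<nu>) ((\<Prod>i=1..k. 1 - xv i) * (\<Prod>i=1..n. xv i ^ \<nu> i))"
  using assms
proof (induction k arbitrary: \<nu>)
  case 0
  then show ?case using lascoux_positive.basis [of \<nu> n] lascoux_dominant [of \<nu> n] by simp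
next
  case (Suc k)
  let ?m = "\<lambda>\<nu>. \<Prod>i=1..n. xv i ^ \<nu> i"
  let ?F = "\<lambda>k \<nu>. (\<Prod>i=1..k. 1 - xv i) * ?m \<nu>"
  have IH: "lascoux_positive n (weight n \<nu>) (?F k \<nu>)"
    using Suc.prems by (intro Suc.IH) auto
  show ?case
  proof (cases "1 \<le> k \<and> \<nu> k = \<nu> (Suc k)")
    case True
    then obtain j where k: "k = Suc j" by (cases k) auto
    let ?G = "(\<Prod>i=1..j. 1 - xv i) * ?m \<nu>"
    have "swap_vars k (?m \<nu>) = ?m \<nu>"
    proof (rule swap_prod_permuted)
      show "bij_betw (transpose k (Suc k)) {1..n} {1..n}"
        using True Suc.prems(3) by (intro permutes_imp_bij permutes_swap_id) auto
      show "swap_vars k (xv i ^ \<nu> i) = xv (transpose k (Suc k) i) ^ \<nu> (transpose k (Suc k) i)" for i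
        using True by (auto simp: transpose_def)
    qed
    moreover have "swap_vars k (\<Prod>i=1..j. 1 - xv i) = (\<Prod>i=1..j. 1 - xv i)"
      by (simp only: swap_hom, rule prod.cong) (auto simp: k transpose_def)
    ultimately have "swap_vars k ?G = ?G" by (simp only: swap_hom(3))
    moreover have "?F k \<nu> = ?G * (1 - xv k)" by (simp add: k ac_simps)
    ultimately have "pi_bar k (?F k \<nu>) = ?G * ((1 - xv k) * (1 - xv (Suc k)))"
      by (simp only: pi_bar_mult_sym pi_bar_one_minus)
    also have "\<dots> = ?F (Suc k) \<nu>" by (simp add: k ac_simps)
    finally show ?thesis
      using lascoux_positive_pi_bar [OF IH, of k] True Suc.prems(3) by simp
  next
    case False
    define \<mu> where "\<mu> = \<nu>(Suc k := Suc (\<nu> (Suc k)))"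
    have sum_split: "sum f {1..n} = f (Suc k) + sum f ({1..n} - {Suc k})" for f :: "nat \<Rightarrow> nat"
      using Suc.prems(3) by (intro sum.remove) auto
    have w: "weight n \<mu> = Suc (weight n \<nu>)"
      unfolding weight_def sum_split by (simp add: \<mu>_def)
    have prod_split: "prod f {1..n} = f (Suc k) * prod f ({1..n} - {Suc k})" for f :: "nat \<Rightarrow> xypoly"
      using Suc.prems(3) by (intro prod.remove) auto
    have m: "?m \<mu> = xv (Suc k) * ?m \<nu>"
      unfolding prod_split by (simp add: \<mu>_def mult.assoc)
    have "\<nu> (Suc k) < \<nu> k" if "1 \<le> k"
      using that False Suc.prems(2) [of k] Suc.prems(3) by auto
    then have "\<mu> (Suc i) \<le> \<mu> i" if "i \<in> {1..<n}" for i
      using that Suc.prems(2) [of i] unfolding \<mu>_def by auto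
    moreover have "\<mu> \<in> compositions n" using Suc.prems by (auto simp: \<mu>_def compositions_def)
    ultimately have "lascoux_positive n (weight n \<mu>) (?F k \<mu>)"
      using Suc.prems(3) by (intro Suc.IH) auto
    from lascoux_positive.add [OF IH this]
    have "lascoux_positive n (weight n \<nu>) (?F k \<nu> - ?F k \<mu>)"
      by (simp add: w)
    also have "?F k \<nu> - ?F k \<mu> = ?F (Suc k) \<nu>"
      unfolding m by (simp add: algebra_simps)
    finally show ?thesis .
  qed
qed

text \<open>The factor is symmetric, so it commutes with the operators that build a Lascoux polynomial from
  its monomial, where \<open>lascoux_positive_partial_product\<close> applies.\<close>

lemma lascoux_positive_empty_column_factor:
  assumes "lascoux_positive n d f"
  shows "lascoux_positive n d (column_factor n 0 * f)"
proof -
  have sym: "swap_vars k (column_factor n 0) = column_factor n 0" if "k \<in> {1..<n}" for k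
  proof -
    have "swap_vars k (\<Prod>i=1..n. 1 - xv i) = (\<Prod>i=1..n. 1 - xv i)"
      using that by (intro swap_prod_permuted permutes_imp_bij permutes_swap_id) auto
    then show ?thesis by (simp add: column_factor_def del: swap_hom(9))
  qed
  have "lascoux_positive n (d + 0) (column_factor n 0 * f)"
  proof (rule lascoux_positive_map [OF assms])
    show "column_factor n 0 * (f + (-1) ^ k * g) = column_factor n 0 * f + (-1) ^ k * (column_factor n 0 * g)"
      for f g k by (simp add: algebra_simps)
    show "lascoux_positive n (weight n \<alpha> + 0) (column_factor n 0 * lascoux n \<alpha>)"
      if "\<alpha> \<in> compositions n" for \<alpha>
      using that
    proof (induction rule: composition_induct)
      case (dominant \<alpha>)
      then show ?case
        using lascoux_positive_partial_product [of \<alpha> n n] lascoux_dominant [of \<alpha> n]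
        by (simp add: column_factor_def)
    next
      case (ascent \<alpha> i)
      have "column_factor n 0 * lascoux n \<alpha> =
          pi_bar i (column_factor n 0 * lascoux n (\<alpha> \<circ> transpose i (Suc i)))"
        using lascoux_ascent [OF ascent(1-3)] pi_bar_mult_sym [OF sym [OF ascent(2)]] by metis
      then show ?case
        using lascoux_positive_pi_bar [OF ascent.IH ascent(2)] by (simp only: weight_swap [OF ascent(2)])
    qed
  qed
  then show ?thesis by simp
qed


section \<open>Reversing and inverting the variables\<close>

text \<open>Polynomials are reversed only after their \<open>y\<close>-variables have been specialized, so the value at
  \<open>Y\<close> is arbitrary.\<close>

definition rev_inv :: "nat \<Rightarrow> (indet \<Rightarrow> xypoly fract) \<Rightarrow> indet \<Rightarrow> xypoly fract" where
  "rev_inv n z v = (case v of X i \<Rightarrow> inverse (z (X (n + 1 - i))) | Y _ \<Rightarrow> 0)"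

text \<open>Inverting variables leaves the polynomial ring, and swapping variables is awkward in a field of
  fractions. Both become substitutions when identities are stated at all evaluation points \<open>z\<close>; the
  conditions on \<open>z\<close> allow division by \<open>x\<^sub>k\<close> and by \<open>x\<^sub>k - x\<^sub>k\<^sub>+\<^sub>1\<close>, and are stable under permuting the
  variables.\<close>

definition generic_point :: "nat \<Rightarrow> (indet \<Rightarrow> xypoly fract) \<Rightarrow> bool" where
  "generic_point n z \<longleftrightarrow> (\<forall>k\<in>{1..n}. z (X k) \<noteq> 0) \<and> inj_on (\<lambda>k. z (X k)) {1..n}"

definition reverses :: "nat \<Rightarrow> nat \<Rightarrow> xypoly \<Rightarrow> xypoly \<Rightarrow> bool" where
  "reverses n r f P \<longleftrightarrow> (\<forall>z. generic_point n z \<longrightarrow>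
    subst z P = (\<Prod>k=1..n. z (X k)) ^ r * subst (rev_inv n z) f)"

text \<open>Each inverted factor \<open>x\<^sub>k\<inverse> - 1\<close> takes up one of the \<open>n\<close> new factors \<open>x\<^sub>k\<close> and becomes \<open>1 - x\<^sub>k\<close>; the
  others remain.\<close>

lemma reverses_column:
  assumes "reverses n r f P" "i \<le> n"
  shows "reverses n (Suc r) ((\<Prod>a=1..i. xv a - 1) * f) (column_factor n (n - i) * P)"
  unfolding reverses_def
proof (intro allI impI)
  fix z assume z: "generic_point n z"
  have nz: "z (X k) \<noteq> 0" if "k \<in> {1..n}" for k using z that by (simp add: generic_point_def)
  have split: "(\<Prod>k=1..n. z (X k)) = (\<Prod>k=1..n-i. z (X k)) * (\<Prod>k=n-i+1..n. z (X k))"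
    using prod.ub_add_nat [of 1 "n - i" "\<lambda>k. z (X k)" i] assms(2) by simp
  have "(\<Prod>a=1..i. inverse (z (X (n + 1 - a))) - 1) = (\<Prod>k=n-i+1..n. inverse (z (X k)) - 1)"
    by (rule prod.reindex_bij_witness [of _ "\<lambda>k. n + 1 - k" "\<lambda>a. n + 1 - a"]) (use assms(2) in auto)
  then have "(\<Prod>k=1..n. z (X k)) * (\<Prod>a=1..i. inverse (z (X (n + 1 - a))) - 1) =
      (\<Prod>k=1..n-i. z (X k)) * (\<Prod>k=n-i+1..n. z (X k) * (inverse (z (X k)) - 1))"
    by (simp only: split prod.distrib mult.assoc)
  also have "(\<Prod>k=n-i+1..n. z (X k) * (inverse (z (X k)) - 1)) = (\<Prod>k=n-i+1..n. 1 - z (X k))"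
    by (intro prod.cong) (use nz in \<open>auto simp: right_diff_distrib\<close>)
  finally have *: "(\<Prod>k=1..n. z (X k)) * (\<Prod>a=1..i. inverse (z (X (n + 1 - a))) - 1) =
      (\<Prod>k=1..n-i. z (X k)) * (\<Prod>k=n-i+1..n. 1 - z (X k))" .
  have "subst z P = (\<Prod>k=1..n. z (X k)) ^ r * subst (rev_inv n z) f"
    using assms(1) z by (simp add: reverses_def)
  then show "subst z (column_factor n (n - i) * P) =
      (\<Prod>k=1..n. z (X k)) ^ Suc r * subst (rev_inv n z) ((\<Prod>a=1..i. xv a - 1) * f)"
    using * by (simp add: column_factor_def rev_inv_def mult_ac)
qed

text \<open>With \<open>k = n - i\<close>, the substitution sends \<open>x\<^sub>i - x\<^sub>i\<^sub>+\<^sub>1\<close> to \<open>(x\<^sub>k - x\<^sub>k\<^sub>+\<^sub>1) / (x\<^sub>k x\<^sub>k\<^sub>+\<^sub>1)\<close> and \<open>x\<^sub>i - 1\<close> to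
  \<open>(1 - x\<^sub>k\<^sub>+\<^sub>1) / x\<^sub>k\<^sub>+\<^sub>1\<close>, so that \<open>\<partial>\<^sub>i((x\<^sub>i - 1) f)\<close> becomes \<open>\<partial>\<^sub>k(x\<^sub>k (1 - x\<^sub>k\<^sub>+\<^sub>1) P)\<close>. The power of
  \<open>x\<^sub>1 \<cdots> x\<^sub>n\<close> is symmetric and passes through.\<close>

lemma reverses_demazure:
  assumes "reverses n r f P" "i \<in> {1..<n}"
  shows "reverses n r (dd i ((xv i - 1) * f)) (pi_bar (n - i) P)"
  unfolding reverses_def
proof (intro allI impI)
  fix z assume z: "generic_point n z"
  define k where "k = n - i"
  have k: "k \<in> {1..<n}" using assms(2) by (auto simp: k_def)
  have idx: "n + 1 - i = Suc k" "n + 1 - Suc i = k" using assms(2) by (auto simp: k_def)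
  let ?s = "transpose k (Suc k)"
  define z' where "z' = (\<lambda>v. case v of X j \<Rightarrow> z (X (?s j)) | Y j \<Rightarrow> z (Y j))"
  have perm: "?s permutes {1..n}" using k by (intro permutes_swap_id) auto
  have "inj_on (\<lambda>j. z (X (?s j))) {1..n}"
    using comp_inj_on [of ?s "{1..n}" "\<lambda>j. z (X j)"] permutes_inj_on [OF perm, of "{1..n}"]
      permutes_image [OF perm] z by (simp add: generic_point_def o_def)
  then have z': "generic_point n z'"
    using z permutes_in_image [OF perm] by (simp add: generic_point_def z'_def)
  have prod': "(\<Prod>j=1..n. z' (X j)) = (\<Prod>j=1..n. z (X j))"
    using prod.permute [OF perm, of "\<lambda>j. z (X j)"] by (simp add: z'_def o_def)
  have swap_P: "subst z (swap_vars k P) = subst z' P"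
    unfolding swap_vars_def subst_comp z'_def
    by (intro arg_cong [where f = "\<lambda>\<sigma>. subst \<sigma> P"] ext) (simp split: indet.split)
  have tr: "?s (n + 1 - j) = n + 1 - transpose i (Suc i) j" for j
    using assms(2) by (auto simp: transpose_def k_def)
  have swap_f: "subst (rev_inv n z) (swap_vars i f) = subst (rev_inv n z') f"
    unfolding swap_vars_def subst_comp
    by (intro arg_cong [where f = "\<lambda>\<sigma>. subst \<sigma> f"] ext)
      (simp add: rev_inv_def z'_def tr [simplified] split: indet.split)
  define x y where "x = z (X k)" and "y = z (X (Suc k))"
  have xy: "x \<noteq> 0" "y \<noteq> 0" "x \<noteq> y"
    using z k inj_on_eq_iff [of "\<lambda>k. z (X k)" "{1..n}" k "Suc k"]
    unfolding x_def y_def generic_point_def by auto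
  define E F f0 f1 where "E = (\<Prod>j=1..n. z (X j)) ^ r" and
    "F = subst (rev_inv n z) (dd i ((xv i - 1) * f))" and
    "f0 = subst (rev_inv n z) f" and "f1 = subst (rev_inv n z) (swap_vars i f)"
  have rP: "subst z P = E * f0" using assms(1) z by (simp add: reverses_def E_def f0_def)
  have "subst z' P = (\<Prod>j=1..n. z' (X j)) ^ r * subst (rev_inv n z') f"
    using assms(1) z' unfolding reverses_def by blast
  then have rP': "subst z (swap_vars k P) = E * f1"
    by (simp only: swap_P f1_def swap_f E_def prod')
  have rx: "rev_inv n z (X i) = inverse y" "rev_inv n z (X (Suc i)) = inverse x"
    unfolding rev_inv_def x_def y_def indet.case idx by simp_all
  have "(xv i - xv (Suc i)) * dd i ((xv i - 1) * f) = (xv i - 1) * f - (xv (Suc i) - 1) * swap_vars i f"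
    by (simp add: dd_eq)
  from arg_cong [OF this, of "subst (rev_inv n z)"]
  have "(inverse y - inverse x) * F = (inverse y - 1) * f0 - (inverse x - 1) * f1"
    by (simp only: subst_mult subst_diff subst_var subst_1 rx F_def f0_def f1_def)
  then have F: "(x - y) * F = x * (1 - y) * f0 - y * (1 - x) * f1"
    using xy by (simp add: field_simps)
  have "(xv k - xv (Suc k)) * pi_bar k P =
      (1 - xv (Suc k)) * (xv k * P) - (1 - xv k) * (xv (Suc k) * swap_vars k P)"
    by (simp add: pi_bar_def dd_bar_def dd_eq)
  from arg_cong [OF this, of "subst z"]
  have "(x - y) * subst z (pi_bar k P) = (1 - y) * (x * (E * f0)) - (1 - x) * (y * (E * f1))"
    by (simp only: subst_mult subst_diff subst_var subst_1 rP rP' x_def y_def)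
  also have "\<dots> = (x - y) * (E * F)"
    unfolding mult.left_commute [of "x - y"] F by (simp add: algebra_simps)
  finally have "subst z (pi_bar k P) = E * F" using xy by simp
  then show "subst z (pi_bar (n - i) P) =
      (\<Prod>k=1..n. z (X k)) ^ r * subst (rev_inv n z) (dd i ((xv i - 1) * f))"
    by (simp add: k_def E_def F_def)
qed


section \<open>Orthodontic polynomials\<close>

text \<open>The case \<open>i = 0\<close> of \<open>column\<close> is multiplication by \<open>1\<close>. It stands for an empty column and raises
  \<open>r\<close> alone, which \<open>orthodontic_pad\<close> uses.\<close>

inductive orthodontic :: "nat \<Rightarrow> nat \<Rightarrow> xypoly \<Rightarrow> bool" for n where
  one: "orthodontic n 0 1"
| column: "orthodontic n (Suc r) ((\<Prod>a=1..i. xv a - 1) * f)" if "orthodontic n r f" "i \<le> n"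
| demazure: "orthodontic n r (dd i ((xv i - 1) * f))" if "orthodontic n r f" "i \<in> {1..<n}"

definition columns_positive :: "nat \<Rightarrow> bool" where
  "columns_positive n \<longleftrightarrow> (\<forall>\<alpha>\<in>compositions n. \<forall>i\<in>{1..n}. graded_nonneg n (column_factor n i * lascoux n \<alpha>))"

lemma orthodontic_positive:
  assumes "columns_positive n" "orthodontic n r f"
  shows "\<exists>P d. reverses n r f P \<and> lascoux_positive n d P"
  using assms(2)
proof induction
  case one
  have "lascoux n (\<lambda>_. 0) = 1" by (simp add: lascoux_dominant compositions_def)
  then have "lascoux_positive n (weight n (\<lambda>_. 0)) 1"
    using lascoux_positive.basis [of "\<lambda>_. 0" n] by (simp add: compositions_def)
  moreover have "reverses n 0 1 1" by (simp add: reverses_def)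
  ultimately show ?case by blast
next
  case (column r f i)
  then obtain P d where P: "reverses n r f P" "lascoux_positive n d P" by blast
  have "lascoux_positive n (d + (n - i)) (column_factor n (n - i) * P)"
  proof (cases "i = n")
    case True
    then show ?thesis using lascoux_positive_empty_column_factor [OF P(2)] by simp
  next
    case False
    then show ?thesis
      using assms(1) column.hyps P(2) unfolding columns_positive_def
      by (intro lascoux_positive_column_factor) auto
  qed
  then show ?case using reverses_column [OF P(1) column.hyps(2)] by blast
next
  case (demazure r f i)
  then obtain P d where P: "reverses n r f P" "lascoux_positive n d P" by blast
  have "n - i \<in> {1..<n}" using demazure.hyps(2) by auto
  then show ?case
    using reverses_demazure [OF P(1) demazure.hyps(2)] lascoux_positive_pi_bar [OF P(2)] by blast
qed

lemma orthodontic_pad: "orthodontic n r f \<Longrightarrow> r \<le> s \<Longrightarrow> orthodontic n s f"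
proof (induction s)
  case (Suc s)
  then show ?case using orthodontic.column [of n s f 0] by (cases "r = Suc s") auto
qed simp

lemma orthodontic_column_power:
  assumes "orthodontic n r f" "i \<le> n"
  shows "orthodontic n (r + k) ((\<Prod>a=1..i. xv a - 1) ^ k * f)"
proof (induction k)
  case (Suc k)
  then show ?case using orthodontic.column [OF Suc assms(2)] by (simp add: mult.assoc)
qed (use assms in simp)

definition specialize :: "int \<Rightarrow> xypoly \<Rightarrow> xypoly" where
  "specialize c = subst (\<lambda>v. case v of X k \<Rightarrow> xv k | Y _ \<Rightarrow> of_int c)"

lemma specialize_hom [simp]:
  "specialize c (f + g) = specialize c f + specialize c g"
  "specialize c (f - g) = specialize c f - specialize c g"
  "specialize c (f * g) = specialize c f * specialize c g" "specialize c 1 = 1"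
  "specialize c (prod F A) = (\<Prod>x\<in>A. specialize c (F x))"
  "specialize c (xv k) = xv k" "specialize c (yv j) = of_int c"
  by (simp_all add: specialize_def)

lemma specialize_swap: "specialize c (swap_vars i f) = swap_vars i (specialize c f)"
  unfolding specialize_def swap_vars_def subst_comp
  by (intro arg_cong [where f = "\<lambda>\<sigma>. subst \<sigma> f"] ext) (simp split: indet.split)

lemma specialize_dd: "specialize c (dd i f) = dd i (specialize c f)"
proof (rule dd_eqI [symmetric])
  show "(xv i - xv (Suc i)) * specialize c (dd i f) = specialize c f - swap_vars i (specialize c f)"
    using arg_cong [OF dd_eq [of i f], of "specialize c"] by (simp add: specialize_swap)
qed

lemma specialize_pi_op: "specialize (-1) (pi_op i j f) = dd i ((xv i - 1) * specialize (-1) f)"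
  by (simp add: pi_op_def specialize_dd)

lemma specialize_omega: "specialize (-1) (omega i M) = (\<Prod>a=1..i. xv a - 1) ^ card M"
  by (simp add: omega_def prod_power_distrib)

lemma orthodontic_reversed_inverse:
  assumes "columns_positive n" "orthodontic n r (specialize c f)"
  shows "\<exists>P. to_fract P = (\<Prod>i=1..n. to_fract (xv i) ^ r) * reversed_inverse n c f \<and> graded_nonneg n P"
proof -
  obtain P d where P: "reverses n r (specialize c f) P" "lascoux_positive n d P"
    using orthodontic_positive [OF assms] by blast
  let ?z = "\<lambda>v. to_fract (var v)"
  have "xv k \<noteq> 0" for k by (simp add: var_def)
  then have "generic_point n ?z" by (auto simp: generic_point_def inj_on_def)
  then have "subst ?z P = (\<Prod>k=1..n. to_fract (xv k)) ^ r * subst (rev_inv n ?z) (specialize c f)"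
    using P(1) by (simp add: reverses_def)
  moreover have "subst ?z P = to_fract P" using subst_to_fract [of var P] by (simp add: subst_var_self)
  moreover have "subst (rev_inv n ?z) (specialize c f) = reversed_inverse n c f"
    unfolding specialize_def reversed_inverse_def subst_comp
    by (intro arg_cong [where f = "\<lambda>\<sigma>. subst \<sigma> f"] ext) (simp add: rev_inv_def split: indet.split)
  ultimately show ?thesis
    using lascoux_positive_graded_nonneg [OF P(2)] by (auto simp: prod_power_distrib)
qed


section \<open>Orthodontia\<close>

text \<open>The invariant of the orthodontic steps: columns \<open>{1..i}\<close> have been removed, so every
  nonempty column has a missing tooth.\<close>

definition stripped :: "nat \<Rightarrow> nat \<Rightarrow> (nat \<times> nat) set \<Rightarrow> bool" where
  "stripped n m E \<longleftrightarrow> E \<subseteq> {1..n} \<times> {1..m} \<and> (\<forall>j. \<forall>i\<in>{1..n}. column E j \<noteq> {1..i})"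

definition support :: "(nat \<times> nat) set \<Rightarrow> nat set" where
  "support E = {j. column E j \<noteq> {}}"

lemma column_remove_columns: "column (remove_columns J D) j = (if j \<in> J then {} else column D j)"
  by (auto simp: column_def remove_columns_def)

lemma column_swap_rows:
  "column (swap_rows E) j = transpose (step_i E) (Suc (step_i E)) ` column E j"
  by (force simp: column_def swap_rows_def)

lemma support_subset: "E \<subseteq> {1..n} \<times> {1..m} \<Longrightarrow> support E \<subseteq> {1..m}"
  by (auto simp: support_def column_def)

lemma stripped_initial_diagram:
  assumes "D \<subseteq> {1..n} \<times> {1..m}"
  shows "stripped n m (initial_diagram n D)"
  unfolding stripped_def
proof (intro conjI allI ballI)
  show "initial_diagram n D \<subseteq> {1..n} \<times> {1..m}"
    using assms by (auto simp: initial_diagram_def remove_columns_def)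
  show "column (initial_diagram n D) j \<noteq> {1..i}" if "i \<in> {1..n}" for i j
    using that by (auto simp: initial_diagram_def column_remove_columns interval_columns_def)
qed

text \<open>A nonempty column without a missing tooth is closed downwards, hence an interval \<open>{1..M}\<close>.\<close>

lemma step_i_range:
  assumes "stripped n m E" "E \<noteq> {}"
  shows "step_i E \<in> {1..<n}"
proof -
  define C where "C = column E (first_column E)"
  from \<open>E \<noteq> {}\<close> obtain i j where "(i, j) \<in> E" by auto
  then have "column E j \<noteq> {}" by (auto simp: column_def)
  then have C: "C \<noteq> {}" unfolding C_def first_column_def by (rule LeastI)
  have Cn: "C \<subseteq> {1..n}" using assms(1) by (auto simp: C_def stripped_def column_def)
  have "\<exists>i. missing_tooth C i"
  proof (rule ccontr)
    assume "\<not> ?thesis"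
    then have down: "i \<in> C" if "Suc i \<in> C" "1 \<le> i" for i using that by (auto simp: missing_tooth_def)
    define M where "M = Max C"
    have fin: "finite C" using Cn finite_subset by blast
    then have M: "M \<in> C" "\<And>i. i \<in> C \<Longrightarrow> i \<le> M" using C by (simp_all add: M_def)
    have "M - k \<in> C" if "k < M" for k
      using that
    proof (induction k)
      case (Suc k)
      then have "Suc (M - Suc k) \<in> C" by (simp add: Suc_diff_Suc)
      then show ?case by (rule down) (use Suc.prems in simp)
    qed (use M in simp)
    have "{1..M} \<subseteq> C"
    proof
      fix i assume "i \<in> {1..M}"
      then show "i \<in> C" using \<open>\<And>k. k < M \<Longrightarrow> M - k \<in> C\<close> [of "M - i"] by simp
    qed
    then have "C = {1..M}" using M Cn by auto
    moreover have "M \<in> {1..n}" using M Cn by auto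
    ultimately show False using assms(1) by (auto simp: stripped_def C_def)
  qed
  then have "missing_tooth C (step_i E)" unfolding step_i_def C_def [symmetric] by (rule LeastI_ex)
  then show ?thesis using Cn by (auto simp: missing_tooth_def)
qed

text \<open>Swapping rows \<open>i\<close> and \<open>i + 1\<close> fixes all intervals \<open>{1..r}\<close> except \<open>{1..i}\<close>, and the columns that
  become \<open>{1..i}\<close> are removed.\<close>

lemma stripped_ortho_step:
  assumes "stripped n m E" "E \<noteq> {}"
  shows "stripped n m (ortho_step E)"
  unfolding stripped_def
proof (intro conjI allI ballI)
  define i where "i = step_i E"
  have i: "i \<in> {1..<n}" using step_i_range [OF assms] by (simp add: i_def)
  show "ortho_step E \<subseteq> {1..n} \<times> {1..m}"
    using assms(1) i unfolding i_def
    by (force simp: stripped_def ortho_step_def remove_columns_def swap_rows_def transpose_def)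
  fix j r assume r: "r \<in> {1..n}"
  show "column (ortho_step E) j \<noteq> {1..r}"
  proof
    assume eq: "column (ortho_step E) j = {1..r}"
    then have j: "j \<notin> step_M E" "transpose i (Suc i) ` column E j = {1..r}"
      using r by (auto simp: ortho_step_def column_remove_columns column_swap_rows i_def split: if_splits)
    then have "r \<noteq> i" by (auto simp: step_M_def interval_columns_def column_swap_rows i_def)
    then have "transpose i (Suc i) ` {1..r} = {1..r}"
      using i by (intro transpose_image_eq) auto
    then have "column E j = {1..r}" using j(2) by (metis inj_image_eq_iff inj_transpose)
    then show False using assms(1) r by (auto simp: stripped_def)
  qed
qed

lemma card_support_ortho_step:
  assumes "stripped n m E" "E \<noteq> {}"
  shows "card (support (ortho_step E)) + card (step_M E) = card (support E)"
proof -
  have "step_M E \<subseteq> support E"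
    using step_i_range [OF assms] by (auto simp: step_M_def interval_columns_def column_swap_rows support_def)
  moreover have "support (ortho_step E) = support E - step_M E"
    by (auto simp: support_def ortho_step_def column_remove_columns column_swap_rows)
  moreover have "finite (support E)"
    using finite_subset [OF support_subset [of E n m]] assms(1) by (simp add: stripped_def)
  ultimately show ?thesis
    by (simp add: card_Diff_subset finite_subset card_mono)
qed

text \<open>Every column is counted once, at the step that removes it, so the number of nonempty columns
  bounds the number of column factors. The bound holds for every initial segment of the process, as
  long as the diagrams to which steps are applied are nonempty.\<close>

lemma orthodontic_steps:
  assumes "stripped n m E" "\<And>k. k < l \<Longrightarrow> (ortho_step ^^ k) E \<noteq> {}"
  shows "orthodontic n (card (support E)) (specialize (-1) (foldr (\<lambda>(i, j, M) f. pi_op i j (omega i M * f))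
    (map (\<lambda>k. let E = (ortho_step ^^ k) E in (step_i E, step_j E, step_M E)) [0..<l]) 1))"
  using assms
proof (induction l arbitrary: E)
  case 0
  then show ?case using orthodontic_pad [OF orthodontic.one] by simp
next
  case (Suc l)
  have ne: "E \<noteq> {}" using Suc.prems(2) [of 0] by simp
  let ?f = "\<lambda>E. foldr (\<lambda>(i, j, M) f. pi_op i j (omega i M * f))
    (map (\<lambda>k. let E = (ortho_step ^^ k) E in (step_i E, step_j E, step_M E)) [0..<l]) 1"
  have shift: "(ortho_step ^^ Suc k) E = (ortho_step ^^ k) (ortho_step E)" for k
    by (simp only: funpow_Suc_right o_def)
  have "(ortho_step ^^ k) (ortho_step E) \<noteq> {}" if "k < l" for k
    using Suc.prems(2) [of "Suc k"] that unfolding shift by simp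
  then have IH: "orthodontic n (card (support (ortho_step E))) (specialize (-1) (?f (ortho_step E)))"
    using Suc.IH [OF stripped_ortho_step [OF Suc.prems(1) ne]] by blast
  have i: "step_i E \<in> {1..<n}" by (rule step_i_range [OF Suc.prems(1) ne])
  have "orthodontic n (card (support E))
      ((\<Prod>a=1..step_i E. xv a - 1) ^ card (step_M E) * specialize (-1) (?f (ortho_step E)))"
    using orthodontic_column_power [OF IH, of "step_i E" "card (step_M E)"] i
      card_support_ortho_step [OF Suc.prems(1) ne] by simp
  from orthodontic.demazure [OF this i]
  show ?case
    unfolding upt_conv_Cons [OF zero_less_Suc] map_Suc_upt [symmetric]
    by (simp add: o_def shift specialize_pi_op specialize_omega del: funpow.simps(2) map_Suc_upt) 
qed

lemma orthodontic_intervals: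
  assumes "orthodontic n r f" "k \<le> n"
  shows "orthodontic n (r + (\<Sum>i=1..k. card (K i))) ((\<Prod>i=1..k. (\<Prod>a=1..i. xv a - 1) ^ card (K i)) * f)"
  using assms(2)
proof (induction k)
  case (Suc k)
  then have "orthodontic n (r + (\<Sum>i=1..k. card (K i))) ((\<Prod>i=1..k. (\<Prod>a=1..i. xv a - 1) ^ card (K i)) * f)"
    by simp
  from orthodontic_column_power [OF this Suc.prems, of "card (K (Suc k))"]
  show ?case by (simp add: ac_simps)
qed (use assms in simp)

lemma orthodontic_ortho_poly:
  assumes D: "D \<subseteq> {1..n} \<times> {1..m}"
  shows "orthodontic n m (specialize (-1) (ortho_poly n D))"
proof -
  let ?E = "initial_diagram n D" and ?K = "interval_columns D"
  have E: "stripped n m ?E" by (rule stripped_initial_diagram [OF D])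
  \<comment> \<open>Minimality of the length gives nonempty diagrams at all earlier steps.\<close>
  have "(ortho_step ^^ k) ?E \<noteq> {}" if "k < ortho_length n D" for k
    using not_less_Least [OF that [unfolded ortho_length_def]] .
  note steps = orthodontic_steps [OF E this]
  have KU: "(\<Sum>i=1..n. card (?K i)) = card (\<Union>i\<in>{1..n}. ?K i)"
  proof (rule card_UN_disjoint [symmetric])
    show "\<forall>i\<in>{1..n}. finite (?K i)"
    proof
      fix i assume "i \<in> {1..n}"
      then have "?K i \<subseteq> support D" by (auto simp: interval_columns_def support_def)
      then show "finite (?K i)" using support_subset [OF D] by (meson finite_atLeastAtMost finite_subset)
    qed
    show "\<forall>i\<in>{1..n}. \<forall>j\<in>{1..n}. i \<noteq> j \<longrightarrow> ?K i \<inter> ?K j = {}"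
      by (auto simp: interval_columns_def)
  qed simp
  have sub: "support ?E \<union> (\<Union>i\<in>{1..n}. ?K i) \<subseteq> {1..m}"
  proof -
    have "(\<Union>i\<in>{1..n}. ?K i) \<subseteq> support D" by (auto simp: interval_columns_def support_def)
    moreover have "support ?E \<subseteq> support D" by (auto simp: support_def initial_diagram_def column_remove_columns)
    ultimately show ?thesis using support_subset [OF D] by blast
  qed
  have disj: "support ?E \<inter> (\<Union>i\<in>{1..n}. ?K i) = {}"
    by (auto simp: support_def initial_diagram_def column_remove_columns)
  have "card (support ?E) + card (\<Union>i\<in>{1..n}. ?K i) = card (support ?E \<union> (\<Union>i\<in>{1..n}. ?K i))"
    using finite_subset [OF sub] disj by (intro card_Un_disjoint [symmetric]) simp_all
  also have "\<dots> \<le> m" using card_mono [OF _ sub] by simp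
  finally have le: "card (support ?E) + (\<Sum>i=1..n. card (?K i)) \<le> m" unfolding KU .
  show ?thesis
    using orthodontic_pad [OF orthodontic_intervals [OF steps order.refl, where K = ?K] le]
    by (simp add: ortho_poly_def ortho_seq_def specialize_omega)
qed


section \<open>Schubert polynomials\<close>

text \<open>Applying the transposition to both positions maps the inversions of \<open>w\<close> injectively to inversions of
  the swapped permutation, and \<open>(i, Suc i)\<close> is a new one.\<close>

lemma inversions_ascent:
  assumes i: "i \<in> {1..<n}" and w: "w i < w (Suc i)"
  shows "inversions n w < inversions n (w \<circ> transpose i (Suc i))"
proof -
  let ?s = "transpose i (Suc i)"
  define I where "I = (\<lambda>w::nat \<Rightarrow> nat. {(a, b). 1 \<le> a \<and> a < b \<and> b \<le> n \<and> w b < w a})"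
  have fin: "finite (I w)" for w
    by (rule finite_subset [of _ "{1..n} \<times> {1..n}"]) (auto simp: I_def)
  have "(?s a, ?s b) \<in> I (w \<circ> ?s) - {(i, Suc i)}" if "(a, b) \<in> I w" for a b
  proof -
    have ab: "1 \<le> a" "a < b" "b \<le> n" "w b < w a" using that by (auto simp: I_def)
    then have "\<not> (a = i \<and> b = Suc i)" using w by auto
    then have "?s a < ?s b" using ab(2) by (auto simp: transpose_def)
    moreover have "1 \<le> ?s a" "?s b \<le> n" using ab i by (auto simp: transpose_def)
    moreover have "(?s a, ?s b) \<noteq> (i, Suc i)" using ab(2) by (auto simp: transpose_def split: if_splits)
    ultimately show ?thesis using ab(4) by (simp add: I_def)
  qed
  then have "map_prod ?s ?s ` I w \<subseteq> I (w \<circ> ?s) - {(i, Suc i)}" by auto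
  then have "card (map_prod ?s ?s ` I w) \<le> card (I (w \<circ> ?s) - {(i, Suc i)})"
    using fin by (intro card_mono) simp_all
  moreover have "inj_on (map_prod ?s ?s) (I w)"
    by (intro inj_on_subset [OF prod.inj_map] inj_transpose) simp
  then have "card (map_prod ?s ?s ` I w) = card (I w)" by (rule card_image)
  moreover have "(i, Suc i) \<in> I (w \<circ> ?s)" using i w by (auto simp: I_def)
  then have "card (I (w \<circ> ?s) - {(i, Suc i)}) < card (I (w \<circ> ?s))"
    using fin by (intro card_Diff1_less)
  ultimately show ?thesis by (simp add: inversions_def I_def)
qed

lemma longest_perm_unique:
  assumes w: "w permutes {1..n}" and dec: "\<And>i. i \<in> {1..<n} \<Longrightarrow> w (Suc i) \<le> w i"
  shows "w = longest_perm n"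
proof
  have less: "w (Suc i) < w i" if "i \<in> {1..<n}" for i
    using dec [OF that] permutes_inj [OF w] by (metis inj_eq le_neq_implies_less n_not_Suc_n)
  have range: "w i \<in> {1..n}" if "i \<in> {1..n}" for i
    using permutes_in_image [OF w] that by blast
  have upper: "Suc k \<le> n \<Longrightarrow> w (Suc k) + k \<le> n" for k
  proof (induction k)
    case 0
    then show ?case using range [of 1] by simp
  next
    case (Suc k)
    then show ?case using less [of "Suc k"] by simp
  qed
  have lower: "k < n \<Longrightarrow> Suc k \<le> w (n - k)" for k
  proof (induction k)
    case 0
    then show ?case using range [of n] by simp
  next
    case (Suc k)
    then have "n - Suc k \<in> {1..<n}" by auto
    then show ?case using less [of "n - Suc k"] Suc by (simp add: Suc_diff_Suc)
  qed
  fix i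
  show "w i = longest_perm n i"
  proof (cases "i \<in> {1..n}")
    case True
    then show ?thesis using upper [of "i - 1"] lower [of "n - i"] by (simp add: longest_perm_def)
  next
    case False
    then show ?thesis using permutes_not_in [OF w, of i] by (auto simp: longest_perm_def)
  qed
qed

lemma permutes_swap:
  assumes "w permutes {1..n}" "i \<in> {1..<n}"
  shows "w \<circ> transpose i (Suc i) permutes {1..n}"
  using assms by (intro permutes_compose permutes_swap_id) auto

text \<open>The comparison of inversion numbers in \<open>double_schubert_rel\<close> says that \<open>i\<close> is an ascent of \<open>w\<close>, and
  the only permutation without ascents is the longest one.\<close>

lemma double_schubert_climb:
  assumes "w permutes {1..n}"
  shows "double_schubert n w = climb dd (\<lambda>_. \<Prod>(i, j) \<in> {(i, j). 1 \<le> i \<and> 1 \<le> j \<and> i + j \<le> n}. xv i - yv (int j)) n w"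
    (is "_ = ?L w")
  unfolding double_schubert_def
proof (rule the_equality)
  have "w permutes {1..n} \<longrightarrow> double_schubert_rel n w (?L w)"
  proof (induction w rule: climb_induct [of n])
    case (dominant w)
    show ?case
    proof
      assume "w permutes {1..n}"
      then have w: "w = longest_perm n" using dominant by (rule longest_perm_unique)
      have "?L w = (\<Prod>(i, j) \<in> {(i, j). 1 \<le> i \<and> 1 \<le> j \<and> i + j \<le> n}. xv i - yv (int j))"
        by (rule climb_dominant) (rule dominant)
      then show "double_schubert_rel n w (?L w)"
        using double_schubert_rel.longest [of n] unfolding w by simp
    qed
  next
    case (ascent w i)
    show ?case
    proof
      assume w: "w permutes {1..n}"
      have L: "?L w = dd i (?L (w \<circ> transpose i (Suc i)))"
        by (rule dd.climb_ascent) fact+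
      show "double_schubert_rel n w (?L w)"
        unfolding L
        by (rule double_schubert_rel.ascent [OF w ascent.hyps(1) inversions_ascent [OF ascent.hyps]])
          (rule ascent.IH [rule_format, OF permutes_swap [OF w ascent.hyps(1)]])
    qed
  qed
  then show "double_schubert_rel n w (?L w)" using assms by blast
next
  fix f assume "double_schubert_rel n w f"
  then show "f = ?L w"
  proof induction
    case longest
    show ?case by (rule climb_dominant [symmetric]) (auto simp: longest_perm_def)
  next
    case (ascent w i f)
    have "w i < w (Suc i)"
    proof (rule ccontr)
      let ?w = "w \<circ> transpose i (Suc i)"
      assume "\<not> ?thesis"
      moreover have "w i \<noteq> w (Suc i)" using permutes_inj [OF ascent.hyps(1)] by (simp add: inj_eq)
      ultimately have "inversions n ?w < inversions n (?w \<circ> transpose i (Suc i))"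
        by (intro inversions_ascent ascent.hyps(2)) simp
      moreover have "?w \<circ> transpose i (Suc i) = w" by (auto simp: fun_eq_iff)
      ultimately show False using ascent.hyps(3) by simp
    qed
    then show ?case unfolding ascent.IH by (intro dd.climb_ascent [symmetric] ascent.hyps(2))
  qed
qed

text \<open>The specialization \<open>y = 1\<close> of the double Schubert polynomial of the longest permutation.\<close>

definition staircase :: "nat \<Rightarrow> xypoly" where
  "staircase n = (\<Prod>i=1..n. (xv i - 1) ^ (n - i))"

lemma staircase_Suc: "staircase (Suc n) = (\<Prod>a=1..n. xv a - 1) * staircase n"
  by (simp add: staircase_def prod.distrib [symmetric] Suc_diff_le)

lemma specialize_staircase:
  "specialize 1 (\<Prod>(i, j) \<in> {(i, j). 1 \<le> i \<and> 1 \<le> j \<and> i + j \<le> n}. xv i - yv (int j)) = staircase n"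
proof -
  have "{(i, j). 1 \<le> i \<and> 1 \<le> j \<and> i + j \<le> n} = (SIGMA i:{1..n}. {1..n - i})" by auto
  then have "(\<Prod>(i, j) \<in> {(i, j). 1 \<le> i \<and> 1 \<le> j \<and> i + j \<le> n}. xv i - yv (int j)) =
      (\<Prod>i=1..n. \<Prod>j=1..n-i. xv i - yv (int j))"
    by (simp add: prod.Sigma)
  then show ?thesis by (simp add: staircase_def)
qed

lemma specialize_climb: "specialize c (climb dd (\<lambda>_. b) n u) = climb dd (\<lambda>_. specialize c b) n u"
proof (induction u rule: climb_induct [of n])
  case (dominant u)
  have "climb dd b n u = b u" for b by (rule climb_dominant) (rule dominant)
  then show ?case by simp
next
  case (ascent u i)
  then show ?case using dd.climb_ascent [of i n u, OF ascent.hyps] by (simp only: specialize_dd)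
qed

text \<open>No ascent of \<open>u\<close> involves the last position, and the operators \<open>\<partial>\<^sub>i\<close> with \<open>i < m\<close> commute with the
  symmetric factor that relates the two staircases.\<close>

lemma climb_staircase_last_minimal:
  assumes "\<And>k. k \<in> {1..m} \<Longrightarrow> u (Suc m) \<le> u k"
  shows "climb dd (\<lambda>_. staircase (Suc m)) (Suc m) u = (\<Prod>a=1..m. xv a - 1) * climb dd (\<lambda>_. staircase m) m u"
  using assms
proof (induction u rule: climb_induct [of m])
  case (dominant u)
  have "u (Suc i) \<le> u i" if "i \<in> {1..<Suc m}" for i
    using that dominant.hyps [of i] dominant.prems [of m] by (cases "i = m") auto
  then show ?case
    using climb_dominant [of "Suc m" u] climb_dominant [of m u] dominant.hyps by (simp add: staircase_Suc)
next
  case (ascent u i)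
  let ?u = "u \<circ> transpose i (Suc i)"
  have IH: "climb dd (\<lambda>_. staircase (Suc m)) (Suc m) ?u = (\<Prod>a=1..m. xv a - 1) * climb dd (\<lambda>_. staircase m) m ?u"
  proof (rule ascent.IH)
    show "?u (Suc m) \<le> ?u k" if "k \<in> {1..m}" for k
      using ascent.prems [of "transpose i (Suc i) k"] ascent.hyps(1) that by (auto simp: transpose_def)
  qed
  have "swap_vars i (\<Prod>a=1..m. xv a - 1) = (\<Prod>a=1..m. xv a - 1)"
    using ascent.hyps(1) by (intro swap_prod_permuted permutes_imp_bij permutes_swap_id) auto
  note sym = dd_mult_sym [OF this]
  have "climb dd (\<lambda>_. staircase (Suc m)) (Suc m) u = dd i (climb dd (\<lambda>_. staircase (Suc m)) (Suc m) ?u)"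
    by (rule dd.climb_ascent) (use ascent.hyps in auto)
  also have "\<dots> = (\<Prod>a=1..m. xv a - 1) * dd i (climb dd (\<lambda>_. staircase m) m ?u)"
    unfolding IH sym ..
  also have "dd i (climb dd (\<lambda>_. staircase m) m ?u) = climb dd (\<lambda>_. staircase m) m u"
    by (rule dd.climb_ascent [symmetric]) fact+
  finally show ?case .
qed

lemma rightmost_minimum:
  fixes u :: "nat \<Rightarrow> nat"
  shows "\<exists>p\<in>{1..Suc m}. (\<forall>k\<in>{1..Suc m}. u p \<le> u k) \<and> (\<forall>k\<in>{p<..Suc m}. u p < u k)"
proof (induction m)
  case (Suc m)
  then obtain p where p: "p \<in> {1..Suc m}" "\<forall>k\<in>{1..Suc m}. u p \<le> u k" "\<forall>k\<in>{p<..Suc m}. u p < u k"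
    by blast
  show ?case
  proof (cases "u (Suc (Suc m)) \<le> u p")
    case True
    then show ?thesis using p by (intro bexI [of _ "Suc (Suc m)"]) (auto simp: le_Suc_eq intro: order.trans)
  next
    case False
    then show ?thesis using p by (intro bexI [of _ p]) (auto simp: le_Suc_eq)
  qed
qed simp

text \<open>Let \<open>p\<close> be the rightmost position of the minimum of \<open>u\<close>. Moving the minimum step by step to the
  last position uses \<open>\<partial>\<^sub>p, \<dots>, \<partial>\<^sub>m\<close>, and there \<open>climb_staircase_last_minimal\<close> splits off the
  column \<open>(x\<^sub>1 - 1) \<cdots> (x\<^sub>m - 1)\<close>. Each \<open>\<partial>\<^sub>a\<close>, applied to a column of length \<open>a\<close> times \<open>g\<close>, shortens the
  column by its last factor, which stays inside as \<open>\<partial>\<^sub>a((x\<^sub>a - 1) g)\<close>. The recursion depends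
  only on the relative order of the values, so \<open>u\<close> may be any function, and forgetting its minimum
  requires no renumbering.\<close>

lemma orthodontic_climb:
  assumes "n \<le> N"
  shows "orthodontic N n (climb dd (\<lambda>_. staircase n) n u)"
  using assms
proof (induction n arbitrary: u)
  case 0
  have "climb dd (\<lambda>_. staircase 0) 0 u = 1"
    by (subst climb_dominant) (simp_all add: staircase_def)
  then show ?case by (simp add: orthodontic.one)
next
  case (Suc m)
  let ?L = "climb dd (\<lambda>_. staircase (Suc m)) (Suc m)"
  have *: "\<exists>g. orthodontic N m g \<and> ?L u = (\<Prod>a=1..p-1. xv a - 1) * g"
    if "p \<le> Suc m" "1 \<le> p" "\<forall>k\<in>{1..Suc m}. u p \<le> u k" "\<forall>k\<in>{p<..Suc m}. u p < u k" for p u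
    using that
  proof (induction p arbitrary: u rule: inc_induct)
    case base
    have "?L u = (\<Prod>a=1..m. xv a - 1) * climb dd (\<lambda>_. staircase m) m u"
      using base by (intro climb_staircase_last_minimal) auto
    then show ?case using Suc.IH [of u] Suc.prems by auto
  next
    case (step p)
    let ?s = "transpose p (Suc p)"
    have lt: "u p < u (Suc p)" using step.prems(3) step.hyps by auto
    have "\<exists>g. orthodontic N m g \<and> ?L (u \<circ> ?s) = (\<Prod>a=1..Suc p-1. xv a - 1) * g"
    proof (rule step.IH)
      show "\<forall>k\<in>{1..Suc m}. (u \<circ> ?s) (Suc p) \<le> (u \<circ> ?s) k"
        using step.prems(2) lt by (auto simp: transpose_def)
      show "\<forall>k\<in>{Suc p<..Suc m}. (u \<circ> ?s) (Suc p) < (u \<circ> ?s) k"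
        using step.prems(3) by (auto simp: transpose_def)
    qed simp
    then obtain g where g: "orthodontic N m g" "?L (u \<circ> ?s) = (\<Prod>a=1..p. xv a - 1) * g" by auto
    have "(\<Prod>a=1..p. xv a - 1) = (\<Prod>a=1..p-1. xv a - 1) * (xv p - 1)"
      using step.prems(1) by (cases p) (simp_all add: ac_simps)
    moreover have "swap_vars p (\<Prod>a=1..p-1. xv a - 1) = (\<Prod>a=1..p-1. xv a - 1)"
      by (simp only: swap_hom, rule prod.cong) (auto simp: transpose_def)
    ultimately have "dd p ((\<Prod>a=1..p. xv a - 1) * g) = (\<Prod>a=1..p-1. xv a - 1) * dd p ((xv p - 1) * g)"
      by (simp only: mult.assoc dd_mult_sym)
    moreover have "?L u = dd p (?L (u \<circ> ?s))"
      by (rule dd.climb_ascent) (use step.prems(1) step.hyps lt in auto)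
    ultimately have "?L u = (\<Prod>a=1..p-1. xv a - 1) * dd p ((xv p - 1) * g)"
      by (simp only: g(2))
    moreover have "orthodontic N m (dd p ((xv p - 1) * g))"
      using step.prems(1) step.hyps Suc.prems by (intro orthodontic.demazure g(1)) auto
    ultimately show ?case by blast
  qed
  obtain p where p: "p \<in> {1..Suc m}" "\<forall>k\<in>{1..Suc m}. u p \<le> u k" "\<forall>k\<in>{p<..Suc m}. u p < u k"
    using rightmost_minimum by blast
  obtain g where "orthodontic N m g" "?L u = (\<Prod>a=1..p-1. xv a - 1) * g"
    using *[of p u] p by auto
  moreover have "p - 1 \<le> N" using p(1) Suc.prems by auto
  ultimately show ?case using orthodontic.column [of N m g "p - 1"] by metis
qed

lemma orthodontic_schubert:
  assumes "w permutes {1..n}"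
  shows "orthodontic n n (specialize 1 (double_schubert n w))"
  unfolding double_schubert_climb [OF assms] specialize_climb specialize_staircase
  by (rule orthodontic_climb) simp


section \<open>Lascoux positivity\<close>

theorem proposition4p4:
  assumes "\<And>n \<alpha> i. n \<ge> 1 \<Longrightarrow> \<alpha> \<in> compositions n \<Longrightarrow> i \<in> {1..n} \<Longrightarrow>
    graded_nonneg n ((\<Prod>k=1..i. xv k) * (\<Prod>k=i+1..n. 1 - xv k) * lascoux n \<alpha>)"
  shows "(\<forall>n m D. n \<ge> 1 \<and> D \<subseteq> {1..n} \<times> {1..m} \<and> percent_avoiding D \<longrightarrow>
      (\<exists>P. to_fract P = (\<Prod>i=1..n. to_fract (xv i) ^ m) * reversed_inverse n (-1) (ortho_poly n D)
        \<and> graded_nonneg n P)) \<and>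
    (\<forall>n w. n \<ge> 1 \<and> w permutes {1..n} \<longrightarrow>
      (\<exists>P. to_fract P = (\<Prod>i=1..n. to_fract (xv i) ^ n) * reversed_inverse n 1 (double_schubert n w)
        \<and> graded_nonneg n P))"
proof -
  have "columns_positive n" if "1 \<le> n" for n
    unfolding columns_positive_def column_factor_def using assms that by blast
  then show ?thesis
    using orthodontic_reversed_inverse orthodontic_ortho_poly orthodontic_schubert by meson
qed

end
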